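(* Let $n\in\mathbb{N}$, $0<\alpha<n$ and $1\le p<\frac{n}{\alpha}$. If $f\in\mathcal{M}^\alpha_p(\mathbb{R}^n)$ and $I_\alpha f\in L^1_{loc}(\mathbb{R}^n)$, then for every $\beta\in(n-\alpha p,n]$ there exists a constant $C>0$ depending only on $n,\alpha,\beta,p$ such that $$\|I_\alpha f\|_{BMO^\beta(\mathbb{R}^n)}\le C\|f\|_{\mathcal{M}^\alpha_p(\mathbb{R}^n)}$$ (in particular $I_\alpha f\in BMO^\beta(\mathbb{R}^n)$). In particular, there exist constants $\gamma,C_0>0$ independent of $f$ such that for every cube $Q\subseteq\mathbb{R}^n$ there is $c_Q\in\mathbb{R}$ (depending on $Q$) with $$\int_Q\exp\left(\frac{\gamma\,|I_\alpha f-c_Q|}{\|f\|_{\mathcal{M}^\alpha_p(\mathbb{R}^n)}}\right)d\mathcal{H}^\beta_\infty\le C_0\,\ell(Q)^\beta$$ (for $f$ not almost everywhere zero).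
   Context: Riesz potential: $I_\alpha f(x)=\frac{1}{\gamma(\alpha)}\int_{\mathbb{R}^n}\frac{f(y)}{|x-y|^{n-\alpha}}\,dy$, with $\gamma(\alpha)>0$ the usual normalization constant; $I_\alpha f\in L^1_{loc}(\mathbb{R}^n)$ includes that the integral converges absolutely for a.e. $x$. Morrey space: for $0<\alpha<n$, $1\le p\le n/\alpha$, $\mathcal{M}^\alpha_p(\mathbb{R}^n)$ is the set of measurable $f$ with $\|f\|_{\mathcal{M}^\alpha_p(\mathbb{R}^n)}:=\sup_{Q}\ell(Q)^\alpha\left(\frac{1}{\ell(Q)^n}\int_Q|f|^p\,dy\right)^{1/p}<\infty$, the supremum over all cubes $Q\subseteq\mathbb{R}^n$ with side length $\ell(Q)$. For $0<\beta\le n$, the Hausdorff content of $E\subseteq\mathbb{R}^n$ is $\mathcal{H}^\beta_\infty(E)=\inf\{\sum_{i}\omega_\beta r_i^\beta: E\subset\bigcup_{i=1}^\infty B(x_i,r_i)\}$, $\omega_\beta=\pi^{\beta/2}/\Gamma(\beta/2+1)$. For non-negative $g$, the Choquet integral is $\int_\Omega g\,d\mathcal{H}^\beta_\infty=\int_0^\infty\mathcal{H}^\beta_\infty(\{x\in\Omega:g(x)>t\})\,dt$. Here $\Omega$ is $\mathbb{R}^n$ or an open cube. A function $g$ on $\Omega$ is $\mathcal{H}^\beta_\infty$-quasicontinuous if for every $\epsilon>0$ there is an open set $O\subseteq\Omega$ with $\mathcal{H}^\beta_\infty(O)<\epsilon$ such that $g$ restricted to $\Omega\setminus O$ is continuous;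 functions need only be defined and finite outside a set of zero $\mathcal{H}^\beta_\infty$ content. $L^1(\Omega;\mathcal{H}^\beta_\infty)$ is the set of $\mathcal{H}^\beta_\infty$-quasicontinuous $g$ with $\int_\Omega|g|\,d\mathcal{H}^\beta_\infty<\infty$, and $g\in L^1_{loc}(\mathbb{R}^n;\mathcal{H}^\beta_\infty)$ means $g|_Q\in L^1(Q;\mathcal{H}^\beta_\infty)$ for every (finite, open) cube $Q$. $BMO^\beta(\mathbb{R}^n)$ is the set of $u\in L^1_{loc}(\mathbb{R}^n;\mathcal{H}^\beta_\infty)$ with $$\|u\|_{BMO^\beta(\mathbb{R}^n)}:=\sup_{Q\subseteq\mathbb{R}^n}\inf_{c\in\mathbb{R}}\frac{1}{\ell(Q)^\beta}\int_Q|u-c|\,d\mathcal{H}^\beta_\infty<\infty,$$ the supremum being over all finite cubes $Q$. *)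

theory Defs
  imports "HOL-Analysis.Analysis"
begin

text \<open>Open cubes with sides parallel to the coordinate axes. All cubes below are of this form,
  with \<open>0 < l\<close>.\<close>

definition cube :: "real ^ 'n \<Rightarrow> real \<Rightarrow> (real ^ 'n) set" where
  "cube a l = box a (a + (\<chi> i. l))"

definition powr_ennreal :: "ennreal \<Rightarrow> real \<Rightarrow> ennreal" where
  "powr_ennreal x s = (if x = \<infinity> then \<infinity> else ennreal (enn2real x powr s))"


subsection \<open>Morrey spaces\<close>

definition morrey_norm :: "real \<Rightarrow> real \<Rightarrow> (real ^ 'n \<Rightarrow> real) \<Rightarrow> ennreal" where
  "morrey_norm \<alpha> p f = (SUP (a, l) \<in> UNIV \<times> {0<..}. ennreal (l powr \<alpha>) *
     powr_ennreal ((\<integral>\<^sup>+y\<in>cube a l. ennreal (\<bar>f y\<bar> powr p) \<partial>lebesgue) / ennreal (l ^ CARD('n))) (1 / p))"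

definition morrey_space :: "real \<Rightarrow> real \<Rightarrow> (real ^ 'n \<Rightarrow> real) set" where
  "morrey_space \<alpha> p = {f \<in> borel_measurable lebesgue. morrey_norm \<alpha> p f < \<infinity>}"


subsection \<open>Riesz potentials\<close>

text \<open>Functions that are only defined outside an exceptional set are modelled as partial functions;
  \<open>dom\<close> is their domain of definition.\<close>

definition riesz_const :: "nat \<Rightarrow> real \<Rightarrow> real" where
  "riesz_const n \<alpha> =
     pi powr (real n / 2) * 2 powr \<alpha> * Gamma (\<alpha> / 2) / Gamma ((real n - \<alpha>) / 2)"

definition riesz_kernel :: "real \<Rightarrow> (real ^ 'n \<Rightarrow> real) \<Rightarrow> real ^ 'n \<Rightarrow> real ^ 'n \<Rightarrow> real" where
  "riesz_kernel \<alpha> f x y = f y / norm (x - y) powr (real CARD('n) - \<alpha>)"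

text \<open>The potential is defined at exactly those points where the integral converges absolutely.\<close>

definition riesz_potential :: "real \<Rightarrow> (real ^ 'n \<Rightarrow> real) \<Rightarrow> real ^ 'n \<rightharpoonup> real" where
  "riesz_potential \<alpha> f x =
     (if integrable lebesgue (riesz_kernel \<alpha> f x)
      then Some (1 / riesz_const CARD('n) \<alpha> * (LINT y|lebesgue. riesz_kernel \<alpha> f x y))
      else None)"

definition L1_loc :: "(real ^ 'n \<rightharpoonup> real) set" where
  "L1_loc = {u. (AE x in lebesgue. x \<in> dom u) \<and>
     (\<forall>K. compact K \<longrightarrow> set_integrable lebesgue K (\<lambda>x. the (u x)))}"


subsection \<open>Hausdorff content and Choquet integral\<close>

text \<open>\<^const>\<open>unit_ball_vol\<close> is \<open>\<omega>\<^sub>\<beta>\<close> for real \<open>\<beta>\<close>. Radius \<open>0\<close> gives the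
  empty ball, so that finite covers are included.\<close>

definition hausdorff_content :: "real \<Rightarrow> (real ^ 'n) set \<Rightarrow> ennreal" where
  "hausdorff_content \<beta> E =
     (INF (x, r) \<in> {(x :: nat \<Rightarrow> real ^ 'n, r :: nat \<Rightarrow> real). (\<forall>i. 0 \<le> r i) \<and> E \<subseteq> (\<Union>i. ball (x i) (r i))}.
        (\<Sum>i. ennreal (unit_ball_vol \<beta> * r i powr \<beta>)))"

text \<open>Points where \<open>g\<close> is undefined do not contribute. This is harmless for functions defined
  outside a set of content zero, which \<open>quasicontinuous\<close> below requires.\<close>

definition choquet_integral :: "real \<Rightarrow> (real ^ 'n) set \<Rightarrow> (real ^ 'n \<rightharpoonup> real) \<Rightarrow> ennreal" where
  "choquet_integral \<beta> \<Omega> g =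
     (\<integral>\<^sup>+t\<in>{0..}. hausdorff_content \<beta> {x \<in> \<Omega>. \<exists>v. g x = Some v \<and> t < v} \<partial>lborel)"

text \<open>The exceptional open set \<open>U\<close> is required to contain the points where \<open>g\<close> is undefined. As
  these have content zero, they can be covered by an open set of arbitrarily small content, so this
  is equivalent to continuity of \<open>g\<close> on \<open>(\<Omega> - U) \<inter> dom g\<close>.\<close>

definition quasicontinuous :: "real \<Rightarrow> (real ^ 'n) set \<Rightarrow> (real ^ 'n \<rightharpoonup> real) \<Rightarrow> bool" where
  "quasicontinuous \<beta> \<Omega> g \<longleftrightarrow>
     hausdorff_content \<beta> (\<Omega> - dom g) = 0 \<and>
     (\<forall>\<epsilon>>0. \<exists>U. open U \<and> U \<subseteq> \<Omega> \<and> hausdorff_content \<beta> U < ennreal \<epsilon> \<and>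
        \<Omega> - U \<subseteq> dom g \<and> continuous_on (\<Omega> - U) (\<lambda>x. the (g x)))"

definition L1_content :: "real \<Rightarrow> (real ^ 'n) set \<Rightarrow> (real ^ 'n \<rightharpoonup> real) set" where
  "L1_content \<beta> \<Omega> = {g. quasicontinuous \<beta> \<Omega> g \<and>
     choquet_integral \<beta> \<Omega> (\<lambda>x. map_option abs (g x)) < \<infinity>}"

definition L1_loc_content :: "real \<Rightarrow> (real ^ 'n \<rightharpoonup> real) set" where
  "L1_loc_content \<beta> = {g. \<forall>a l. 0 < l \<longrightarrow> g |` cube a l \<in> L1_content \<beta> (cube a l)}"


subsection \<open>BMO with respect to Hausdorff content\<close>

definition bmo_norm :: "real \<Rightarrow> (real ^ 'n \<rightharpoonup> real) \<Rightarrow> ennreal" where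
  "bmo_norm \<beta> u = (SUP (a, l) \<in> UNIV \<times> {0<..}. INF c.
     choquet_integral \<beta> (cube a l) (\<lambda>x. map_option (\<lambda>v. \<bar>v - c\<bar>) (u x)) / ennreal (l powr \<beta>))"

definition bmo_space :: "real \<Rightarrow> (real ^ 'n \<rightharpoonup> real) set" where
  "bmo_space \<beta> = {u \<in> L1_loc_content \<beta>. bmo_norm \<beta> u < \<infinity>}"

end

theory Submission
  imports Defs
begin

text \<open>Write \<open>n\<close> for the dimension and \<open>s = n - \<alpha>p\<close>, so that \<open>s < \<beta>\<close>, and let \<open>M\<close> bound the Morrey norm of \<open>f\<close>. Both
  inequalities follow from one statement: on every cube \<open>Q\<close> of side \<open>l\<close> there is a constant \<open>c\<close> such that the
  content of \<open>{x \<in> Q. \<bar>I\<^sub>\<alpha> f x - c\<bar> > t}\<close> is at most \<open>A l\<^sup>\<beta> exp(- b t / M)\<close> (\<open>potential_level_sets\<close>).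
  Integrating this over \<open>t\<close> gives the BMO bound, and a substitution gives the exponential one.

  To prove the decay, fix \<open>z \<in> Q\<close> where the potential converges and split \<open>f\<close> at distance \<open>2d\<close> from \<open>z\<close>, where
  \<open>d\<close> is comparable to \<open>l\<close>. The Morrey condition gives that the integral of \<open>\<bar>f\<bar>\<close> over \<open>B(x, r)\<close> is of order
  at most \<open>M r\<^bsup>n-\<alpha>\<^esup>\<close>. Hence each dyadic shell around \<open>x\<close> contributes order \<open>M\<close> to the potential at \<open>x\<close>, and the
  potential of the distant part varies by at most a multiple of \<open>M\<close> on \<open>Q\<close>
  (\<open>distant_potential_oscillation\<close>); its value at \<open>z\<close> supplies \<open>c\<close>.

  For the near part \<open>f\<^sub>1\<close> the only danger is the infinitely many small shells. Call \<open>x\<close> heavy for \<open>T\<close> if some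
  ball around it satisfies \<open>\<integral>\<^bsub>B(x,r)\<^esub> \<bar>f\<^sub>1\<bar>\<^sup>p > T\<^sup>p r\<^sup>\<beta>\<close>, and light otherwise. Vitali's covering lemma bounds the
  content of the heavy points by a multiple of \<open>T\<^bsup>-p\<^esup> \<integral>\<bar>f\<^sub>1\<bar>\<^sup>p\<close>, that is, of \<open>T\<^bsup>-p\<^esup> M\<^sup>p d\<^sup>s\<close>
  (\<open>hausdorff_content_heavy_points\<close>). At a light point, because \<open>\<beta> > s\<close>, the shells inside radius \<open>\<delta>\<close> sum to a
  multiple of \<open>T \<delta>\<^bsup>(\<beta>-s)/p\<^esup>\<close>. Choose \<open>\<delta>\<close> as \<open>N\<close> halvings of \<open>3d\<close>, and \<open>T\<close> such that this sum is of order \<open>M\<close>. Then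
  the potential of \<open>f\<^sub>1\<close> is of order at most \<open>(1 + N) M\<close> off the heavy points, while these have content of order
  at most \<open>d\<^sup>\<beta> 2\<^bsup>-(\<beta>-s)N\<^esup>\<close>. This is the exponential decay (\<open>exponential_decay\<close>).

  The same sets give quasicontinuity. The heavy points form an open set whose content tends to \<open>0\<close> as
  \<open>T\<close> grows; off it the contribution of the shells inside radius \<open>\<delta>\<close> tends to \<open>0\<close> uniformly with \<open>\<delta>\<close>, so the
  potential converges there and is a uniform limit of continuous truncations
  (\<open>continuous_on_light_points\<close>).\<close>

section \<open>Hausdorff content and heavy points\<close>

lemma hausdorff_content_mono:
  assumes "A \<subseteq> B"
  shows "hausdorff_content \<beta> A \<le> hausdorff_content \<beta> B"
  unfolding hausdorff_content_def
  by (rule INF_superset_mono) (use assms in auto)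

lemma hausdorff_content_le_suminf:
  assumes "\<And>i. 0 \<le> r i" "E \<subseteq> (\<Union>i. ball (x i) (r i))"
  shows "hausdorff_content \<beta> E \<le> (\<Sum>i. ennreal (unit_ball_vol \<beta> * r i powr \<beta>))"
  unfolding hausdorff_content_def
  by (rule INF_lower2[where i = "(x, r)"]) (use assms in auto)

text \<open>Covering arguments produce countable families indexed by an arbitrary set, whereas the content is
  defined by sequences of balls. Padding with balls of radius \<open>0\<close> turns one into the other.\<close>

lemma hausdorff_content_le_count_space:
  fixes x :: "'i \<Rightarrow> real ^ 'n::finite"
  assumes C: "countable C" and r: "\<And>i. i \<in> C \<Longrightarrow> 0 \<le> r i"
    and E: "E \<subseteq> (\<Union>i\<in>C. ball (x i) (r i))"
  shows "hausdorff_content \<beta> E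
           \<le> (\<integral>\<^sup>+i. ennreal (unit_ball_vol \<beta> * r i powr \<beta>) \<partial>count_space C)"
proof -
  let ?e = "to_nat_on C" and ?d = "from_nat_into C"
  define I where "I = ?e ` C"
  define r' where "r' k = (if k \<in> I then r (?d k) else 0)" for k
  have bij: "bij_betw ?e C I"
    unfolding I_def using inj_on_to_nat_on[OF C] by (simp add: inj_on_imp_bij_betw)
  have de: "?d (?e i) = i" if "i \<in> C" for i
    using C that by (rule from_nat_into_to_nat_on)
  have "hausdorff_content \<beta> E \<le> (\<Sum>k. ennreal (unit_ball_vol \<beta> * r' k powr \<beta>))"
  proof (rule hausdorff_content_le_suminf)
    show "0 \<le> r' k" for k by (auto simp: r'_def I_def de r)
    show "E \<subseteq> (\<Union>k. ball (x (?d k)) (r' k))"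
    proof
      fix y assume "y \<in> E"
      then obtain i where i: "i \<in> C" "y \<in> ball (x i) (r i)" using E by auto
      then have "y \<in> ball (x (?d (?e i))) (r' (?e i))"
        by (simp add: r'_def I_def de)
      then show "y \<in> (\<Union>k. ball (x (?d k)) (r' k))" by blast
    qed
  qed
  also have "\<dots> = (\<integral>\<^sup>+k. ennreal (unit_ball_vol \<beta> * r' k powr \<beta>) \<partial>count_space UNIV)"
    by (simp add: nn_integral_count_space_nat)
  also have "\<dots> = (\<integral>\<^sup>+k. ennreal (unit_ball_vol \<beta> * r (?d k) powr \<beta>) * indicator I k \<partial>count_space UNIV)"
    by (rule nn_integral_cong) (auto simp: r'_def)
  also have "\<dots> = (\<integral>\<^sup>+k. ennreal (unit_ball_vol \<beta> * r (?d k) powr \<beta>) \<partial>count_space I)"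
    by (simp add: nn_integral_count_space_indicator)
  also have "\<dots> = (\<integral>\<^sup>+i. ennreal (unit_ball_vol \<beta> * r (?d (?e i)) powr \<beta>) \<partial>count_space C)"
    using nn_integral_bij_count_space[OF bij, of "\<lambda>k. ennreal (unit_ball_vol \<beta> * r (?d k) powr \<beta>)"]
    by simp
  also have "\<dots> = (\<integral>\<^sup>+i. ennreal (unit_ball_vol \<beta> * r i powr \<beta>) \<partial>count_space C)"
    by (rule nn_integral_cong) (simp add: de)
  finally show ?thesis .
qed

lemma hausdorff_content_ball_le:
  assumes "0 \<le> r"
  shows "hausdorff_content \<beta> (ball x r) \<le> ennreal (unit_ball_vol \<beta> * r powr \<beta>)"
  using hausdorff_content_le_count_space[of "{x}" "\<lambda>_. r" "ball x r" "\<lambda>x. x" \<beta>] assms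
  by (simp add: nn_integral_count_space_finite)

text \<open>The set where the maximal function \<open>sup\<^sub>r \<mu>(B(x, r)) / r\<^sup>\<beta>\<close> exceeds \<open>t\<close>. Points outside it are called
  light below.\<close>

definition heavy_points :: "real \<Rightarrow> real \<Rightarrow> (real ^ 'n) measure \<Rightarrow> (real ^ 'n) set" where
  "heavy_points \<beta> t \<mu> = {x. \<exists>r>0. ennreal (t * r powr \<beta>) < emeasure \<mu> (ball x r)}"

lemma open_heavy_points:
  fixes \<mu> :: "(real ^ 'n::finite) measure"
  assumes sets: "sets borel \<subseteq> sets \<mu>" 
  shows "open (heavy_points \<beta> t \<mu>)"
  unfolding open_dist
proof
  fix x assume "x \<in> heavy_points \<beta> t \<mu>"
  then obtain r where r: "r > 0" "ennreal (t * r powr \<beta>) < emeasure \<mu> (ball x r)"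
    by (auto simp: heavy_points_def)
  \<comment> \<open>Enlarging the radius slightly keeps the strict inequality; the room gained absorbs a move of the centre.\<close>
  have "((\<lambda>q. ennreal (t * q powr \<beta>)) \<longlongrightarrow> ennreal (t * r powr \<beta>)) (at_right r)"
    using r(1) by (intro tendsto_ennrealI tendsto_intros) auto
  then have "eventually (\<lambda>q. ennreal (t * q powr \<beta>) < emeasure \<mu> (ball x r)) (at_right r)"
    using r(2) by (rule order_tendstoD(2))
  then obtain q0 where "q0 > r"
     and "\<And>q. r < q \<Longrightarrow> q < q0 \<Longrightarrow> ennreal (t * q powr \<beta>) < emeasure \<mu> (ball x r)"
    by (auto simp: eventually_at_right_field)
  then obtain q where q: "r < q" "ennreal (t * q powr \<beta>) < emeasure \<mu> (ball x r)"
    by (metis dense)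
  have "y \<in> heavy_points \<beta> t \<mu>" if y: "dist y x < q - r" for y
  proof -
    have "ball x r \<subseteq> ball y q"
    proof
      fix w assume "w \<in> ball x r"
      then show "w \<in> ball y q"
        using y dist_triangle[of y w x] by simp
    qed
    moreover have "ball y q \<in> sets \<mu>" using sets by (meson open_ball borel_open subsetD)
    ultimately have "emeasure \<mu> (ball x r) \<le> emeasure \<mu> (ball y q)" by (rule emeasure_mono)
    with q(2) have "ennreal (t * q powr \<beta>) < emeasure \<mu> (ball y q)" by (rule less_le_trans)
    then show ?thesis using q r unfolding heavy_points_def by (intro CollectI exI[of _ q]) simp
  qed
  then show "\<exists>e>0. \<forall>y. dist y x < e \<longrightarrow> y \<in> heavy_points \<beta> t \<mu>"
    using q by (intro exI[of _ "q - r"]) auto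
qed

text \<open>The weak type estimate for this maximal function. By Vitali's lemma, countably many disjoint
  heavy balls suffice for their fivefold enlargements to cover the set; each radius is paid for by
  the mass of its ball, \<open>r\<^sup>\<beta> < \<mu>(B) / t\<close>, and disjointness makes the masses add up to at most the total.\<close>

lemma hausdorff_content_heavy_points:
  fixes \<mu> :: "(real ^ 'n::finite) measure"
  assumes sets: "sets borel \<subseteq> sets \<mu>" and fin: "emeasure \<mu> (space \<mu>) \<le> ennreal m" and "0 \<le> m"
    and "0 < t" "0 < \<beta>"
  shows "hausdorff_content \<beta> (heavy_points \<beta> t \<mu>) \<le> ennreal (unit_ball_vol \<beta> * 5 powr \<beta> / t * m)"
proof -
  let ?E = "heavy_points \<beta> t \<mu>"
  have "\<forall>x\<in>?E. \<exists>r>0. ennreal (t * r powr \<beta>) < emeasure \<mu> (ball x r)"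
    by (auto simp: heavy_points_def)
  then obtain r where r: "\<And>x. x \<in> ?E \<Longrightarrow> 0 < r x"
      "\<And>x. x \<in> ?E \<Longrightarrow> ennreal (t * r x powr \<beta>) < emeasure \<mu> (ball x (r x))"
    by metis
  have ballm: "ball x q \<in> sets \<mu>" for x q using sets by (meson open_ball borel_open subsetD)
  \<comment> \<open>The covering lemma needs bounded radii; they are bounded because the total mass is finite.\<close>
  have bound: "r x \<le> (m / t) powr (1 / \<beta>)" if x: "x \<in> ?E" for x
  proof -
    have "ennreal (t * r x powr \<beta>) \<le> ennreal m"
      using r(2)[OF x] emeasure_space[of \<mu> "ball x (r x)"] fin by (meson less_imp_le order_trans)
    then have "r x powr \<beta> \<le> m / t"
      using \<open>0 \<le> m\<close> \<open>0 < t\<close> by (simp add: pos_le_divide_eq mult.commute)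
    then have "(r x powr \<beta>) powr (1 / \<beta>) \<le> (m / t) powr (1 / \<beta>)"
      using \<open>0 < \<beta>\<close> by (intro powr_mono2) auto
    then show ?thesis using r(1)[OF x] \<open>0 < \<beta>\<close> by (simp add: powr_powr)
  qed
  have cov: "?E \<subseteq> (\<Union>x\<in>?E. ball x (r x))" using r(1) by auto
  obtain C where C: "countable C" "C \<subseteq> ?E"
      "pairwise (\<lambda>i j. disjnt (ball i (r i)) (ball j (r j))) C"
      "?E \<subseteq> (\<Union>i\<in>C. ball i (5 * r i))"
    by (rule Vitali_covering_lemma_balls[OF cov, of "(m / t) powr (1 / \<beta>)"]) (auto simp: r(1) bound)
  have disj: "disjoint_family_on (\<lambda>i. ball i (r i)) C"
    using C(3) by (auto simp: disjoint_family_on_def pairwise_def disjnt_def)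
  let ?K = "unit_ball_vol \<beta> * 5 powr \<beta> / t"
  have "hausdorff_content \<beta> ?E \<le> (\<integral>\<^sup>+i. ennreal (unit_ball_vol \<beta> * (5 * r i) powr \<beta>) \<partial>count_space C)"
    using C r(1) by (intro hausdorff_content_le_count_space) (auto simp: less_imp_le subset_iff)
  also have "\<dots> \<le> (\<integral>\<^sup>+i. ennreal ?K * emeasure \<mu> (ball i (r i)) \<partial>count_space C)"
  proof (rule nn_integral_mono)
    fix i assume "i \<in> space (count_space C)"
    then have i: "i \<in> ?E" using C by auto
    have "unit_ball_vol \<beta> * (5 * r i) powr \<beta> = ?K * (t * r i powr \<beta>)"
      using r(1)[OF i] \<open>0 < t\<close> by (simp add: powr_mult)
    also have "ennreal \<dots> = ennreal ?K * ennreal (t * r i powr \<beta>)"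
      using \<open>0 < t\<close> \<open>0 < \<beta>\<close> by (intro ennreal_mult) auto
    also have "\<dots> \<le> ennreal ?K * emeasure \<mu> (ball i (r i))"
      using r(2)[OF i] by (intro mult_left_mono) auto
    finally show "ennreal (unit_ball_vol \<beta> * (5 * r i) powr \<beta>) \<le> ennreal ?K * emeasure \<mu> (ball i (r i))" .
  qed
  also have "\<dots> = ennreal ?K * emeasure \<mu> (\<Union>i\<in>C. ball i (r i))"
    using ballm C(1) disj by (simp add: nn_integral_cmult emeasure_UN_countable)
  also have "\<dots> \<le> ennreal ?K * ennreal m"
    using emeasure_space fin by (intro mult_left_mono) (auto intro: order_trans)
  also have "\<dots> = ennreal (?K * m)"
    using \<open>0 < t\<close> \<open>0 < \<beta>\<close> \<open>0 \<le> m\<close> by (intro ennreal_mult[symmetric]) auto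
  finally show ?thesis .
qed

section \<open>Absolute potentials summed over dyadic shells\<close>

text \<open>Either \<open>\<bar>a\<bar> \<le> m\<close>, or \<open>\<bar>a\<bar> = \<bar>a\<bar>\<^sup>p \<bar>a\<bar>\<^bsup>1-p\<^esup>\<close> with \<open>\<bar>a\<bar>\<^bsup>1-p\<^esup> \<le> m\<^bsup>1-p\<^esup>\<close>. Integrated over a ball and with \<open>m\<close>
  optimized, this replaces Hoelder's inequality.\<close>

lemma abs_le_add_powr:
  fixes a m p :: real
  assumes "1 \<le> p" "0 < m"
  shows "\<bar>a\<bar> \<le> m + m powr (1 - p) * \<bar>a\<bar> powr p"
proof (cases "\<bar>a\<bar> \<le> m")
  case True
  moreover have "0 \<le> m powr (1 - p) * \<bar>a\<bar> powr p" by simp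
  ultimately show ?thesis by linarith
next
  case False
  then have a: "m < \<bar>a\<bar>" by simp
  have "\<bar>a\<bar> powr (1 - p) \<le> m powr (1 - p)"
    using assms a by (intro powr_mono2') auto
  then have "\<bar>a\<bar> powr (1 - p) * \<bar>a\<bar> powr p \<le> m powr (1 - p) * \<bar>a\<bar> powr p"
    by (rule mult_right_mono) simp
  moreover have "\<bar>a\<bar> powr (1 - p) * \<bar>a\<bar> powr p = \<bar>a\<bar>"
    using a assms by (simp flip: powr_add)
  ultimately show ?thesis using assms by linarith
qed

lemma emeasure_lebesgue_ball:
  assumes "0 \<le> r"
  shows "emeasure lebesgue (ball (x :: real ^ 'n::finite) r)
           = ennreal (unit_ball_vol (real CARD('n)) * r ^ CARD('n))"
  using emeasure_ball[OF assms, of x] by simp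

lemma lebesgue_ball_sets: "ball (x :: real ^ 'n::finite) r \<in> sets lebesgue"
  by simp

lemma borel_measurable_lebesgue_of_borel:
  "f \<in> borel_measurable borel \<Longrightarrow> f \<in> borel_measurable lebesgue"
  by (simp add: measurable_completion)

text \<open>Growth of the \<open>p\<close>-th power integral over balls passes to the first power. It is used with \<open>s = n - \<alpha>p\<close>,
  where the new exponent is \<open>n - \<alpha>\<close>, and with \<open>s = \<beta>\<close>, where it exceeds \<open>n - \<alpha>\<close> by
  \<open>(\<beta> - (n - \<alpha>p)) / p > 0\<close>.\<close>

lemma nn_integral_ball_le_of_powr:
  fixes g :: "real ^ 'n::finite \<Rightarrow> real"
  assumes g: "g \<in> borel_measurable lebesgue" and p: "1 \<le> p" and A: "0 < A" and r: "0 < r"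
    and le: "(\<integral>\<^sup>+y\<in>ball x r. ennreal (\<bar>g y\<bar> powr p) \<partial>lebesgue) \<le> ennreal (A powr p * r powr s)"
  shows "(\<integral>\<^sup>+y\<in>ball x r. ennreal \<bar>g y\<bar> \<partial>lebesgue)
    \<le> ennreal ((1 + unit_ball_vol (real CARD('n))) * A *
               r powr (real CARD('n) + (s - real CARD('n)) / p))"
proof -
  let ?n = "real CARD('n)" and ?\<omega> = "unit_ball_vol (real CARD('n))"
  note [measurable] = g lebesgue_ball_sets[of x r]
  \<comment> \<open>With this threshold \<open>m\<close> the two terms \<open>m r\<^sup>n\<close> and
    \<open>m\<^bsup>1-p\<^esup> \<integral>\<bar>g\<bar>\<^sup>p\<close> have the same order.\<close>
  define m where "m = A * r powr ((s - ?n) / p)"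
  have m: "0 < m" using A r by (simp add: m_def)
  have rn: "r ^ CARD('n) = r powr ?n" using r by (simp add: powr_realpow)
  have mp: "m powr p = A powr p * r powr (s - ?n)"
    using A r p by (simp add: m_def powr_mult powr_powr)
  have "(\<integral>\<^sup>+y\<in>ball x r. ennreal \<bar>g y\<bar> \<partial>lebesgue)
      \<le> (\<integral>\<^sup>+y. ennreal m * indicator (ball x r) y +
            ennreal (m powr (1 - p)) * (ennreal (\<bar>g y\<bar> powr p) * indicator (ball x r) y) \<partial>lebesgue)"
  proof (rule nn_integral_mono)
    fix y
    have "ennreal \<bar>g y\<bar> \<le> ennreal (m + m powr (1 - p) * \<bar>g y\<bar> powr p)"
      using abs_le_add_powr[OF p m] by (rule ennreal_leI)
    also have "\<dots> = ennreal m + ennreal (m powr (1 - p)) * ennreal (\<bar>g y\<bar> powr p)"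
      using m by (simp add: ennreal_mult)
    finally show "ennreal \<bar>g y\<bar> * indicator (ball x r) y \<le> ennreal m * indicator (ball x r) y +
            ennreal (m powr (1 - p)) * (ennreal (\<bar>g y\<bar> powr p) * indicator (ball x r) y)"
      by (simp add: indicator_def)
  qed
  also have "\<dots> = ennreal m * emeasure lebesgue (ball x r) +
      ennreal (m powr (1 - p)) * (\<integral>\<^sup>+y\<in>ball x r. ennreal (\<bar>g y\<bar> powr p) \<partial>lebesgue)"
    by (simp add: nn_integral_add nn_integral_cmult nn_integral_cmult_indicator)
  also have "\<dots> \<le> ennreal m * ennreal (?\<omega> * r powr ?n) +
      ennreal (m powr (1 - p)) * ennreal (A powr p * r powr s)"
    using le emeasure_lebesgue_ball[of r x] r
    by (intro add_mono mult_left_mono) (simp_all add: rn)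
  also have "\<dots> = ennreal (m * (?\<omega> * r powr ?n) + m powr (1 - p) * (A powr p * r powr s))"
    using m by (subst ennreal_plus) (auto simp: ennreal_mult)
  also have "m powr (1 - p) * (A powr p * r powr s) = m powr (1 - p) * (m powr p * r powr ?n)"
    using r by (simp add: mp flip: powr_add)
  also have "\<dots> = m * r powr ?n"
    using m by (simp add: mult.assoc[symmetric] flip: powr_add)
  also have "m * (?\<omega> * r powr ?n) + m * r powr ?n = (1 + ?\<omega>) * A * (r powr ((s - ?n) / p) * r powr ?n)"
    by (simp add: m_def algebra_simps)
  also have "r powr ((s - ?n) / p) * r powr ?n = r powr (?n + (s - ?n) / p)"
    by (simp add: add.commute flip: powr_add)
  finally show ?thesis .
qed

definition abs_potential :: "real \<Rightarrow> (real ^ 'n \<Rightarrow> real) \<Rightarrow> (real ^ 'n) set \<Rightarrow> real ^ 'n \<Rightarrow> ennreal" where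
  "abs_potential \<sigma> g S x = (\<integral>\<^sup>+y\<in>S. ennreal (\<bar>g y\<bar> * norm (x - y) powr - \<sigma>) \<partial>lebesgue)"

lemma borel_measurable_abs_kernel:
  fixes g :: "real ^ 'n::finite \<Rightarrow> real"
  assumes [measurable]: "g \<in> borel_measurable lebesgue"
  shows "(\<lambda>y. ennreal (\<bar>g y\<bar> * norm (x - y) powr - \<sigma>)) \<in> borel_measurable lebesgue"
proof -
  have [measurable]: "(\<lambda>y. norm (x - y) powr - \<sigma>) \<in> borel_measurable lebesgue"
    by (rule borel_measurable_lebesgue_of_borel) measurable
  show ?thesis by measurable
qed

lemma abs_potential_Un_le:
  fixes g :: "real ^ 'n::finite \<Rightarrow> real"
  assumes g: "g \<in> borel_measurable lebesgue"
    and S: "S \<in> sets lebesgue" and T: "T \<in> sets lebesgue"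
  shows "abs_potential \<sigma> g (S \<union> T) x \<le> abs_potential \<sigma> g S x + abs_potential \<sigma> g T x"
proof -
  note [measurable] = borel_measurable_abs_kernel[OF g] S T
  have "abs_potential \<sigma> g S x + abs_potential \<sigma> g T x =
      (\<integral>\<^sup>+y. ennreal (\<bar>g y\<bar> * norm (x - y) powr - \<sigma>) * indicator S y +
            ennreal (\<bar>g y\<bar> * norm (x - y) powr - \<sigma>) * indicator T y \<partial>lebesgue)"
    unfolding abs_potential_def by (rule nn_integral_add[symmetric]) measurable
  then show ?thesis
    unfolding abs_potential_def by (auto intro!: nn_integral_mono simp: indicator_def)
qed

text \<open>On the shell \<open>\<rho>\<^sub>k / 2 \<le> \<bar>x - y\<bar> < \<rho>\<^sub>k\<close> the kernel is at most \<open>(\<rho>\<^sub>k / 2)\<^bsup>-\<sigma>\<^esup>\<close>, and the shell lies in a ball on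
  which the integral of \<open>\<bar>g\<bar>\<close> is controlled. The point \<open>y = x\<close> lies in no shell, but the kernel vanishes
  there by convention.\<close>

lemma abs_potential_le_shells:
  fixes g :: "real ^ 'n::finite \<Rightarrow> real"
  assumes g: "g \<in> borel_measurable lebesgue" and \<sigma>: "0 < \<sigma>"
    and cov: "\<And>y. y \<in> S \<Longrightarrow> y \<noteq> x \<Longrightarrow> \<exists>k. \<rho> k / 2 \<le> norm (x - y) \<and> norm (x - y) < \<rho> k"
    and J: "\<And>k. (\<integral>\<^sup>+y\<in>ball x (\<rho> k). ennreal \<bar>g y\<bar> \<partial>lebesgue) \<le> ennreal (J k)"
  shows "abs_potential \<sigma> g S x \<le> (\<Sum>k. ennreal ((\<rho> k / 2) powr - \<sigma> * J k))"
proof -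
  note [measurable] = g lebesgue_ball_sets
  let ?h = "\<lambda>k y. ennreal ((\<rho> k / 2) powr - \<sigma>) * (ennreal \<bar>g y\<bar> * indicator (ball x (\<rho> k)) y)"
  have "abs_potential \<sigma> g S x \<le> (\<integral>\<^sup>+y. (\<Sum>k. ?h k y) \<partial>lebesgue)"
    unfolding abs_potential_def
  proof (rule nn_integral_mono)
    fix y
    show "ennreal (\<bar>g y\<bar> * norm (x - y) powr - \<sigma>) * indicator S y \<le> (\<Sum>k. ?h k y)"
    proof (cases "y \<in> S \<and> y \<noteq> x")
      case True
      then obtain k where k: "\<rho> k / 2 \<le> norm (x - y)" "norm (x - y) < \<rho> k" using cov by blast
      have pos: "0 < \<rho> k" using k(2) norm_ge_zero[of "x - y"] by linarith
      have "norm (x - y) powr - \<sigma> \<le> (\<rho> k / 2) powr - \<sigma>"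
        using \<sigma> pos k by (intro powr_mono2') auto
      then have "ennreal (\<bar>g y\<bar> * norm (x - y) powr - \<sigma>) \<le> ennreal (\<bar>g y\<bar> * (\<rho> k / 2) powr - \<sigma>)"
        by (intro ennreal_leI mult_left_mono) auto
      also have "\<dots> = ?h k y"
        using k by (simp add: dist_norm ennreal_mult mult.commute)
      also have "\<dots> \<le> (\<Sum>k. ?h k y)"
        using sum_le_suminf[of "\<lambda>k. ?h k y" "{k}"] by simp
      finally show ?thesis using True by simp
    qed (auto simp: indicator_def)
  qed
  also have "\<dots> = (\<Sum>k. \<integral>\<^sup>+y. ?h k y \<partial>lebesgue)"
    by (intro nn_integral_suminf) measurable
  also have "\<dots> \<le> (\<Sum>k. ennreal ((\<rho> k / 2) powr - \<sigma> * J k))"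
  proof (rule suminf_le)
    fix k
    have "(\<integral>\<^sup>+y. ?h k y \<partial>lebesgue) = ennreal ((\<rho> k / 2) powr - \<sigma>) * (\<integral>\<^sup>+y\<in>ball x (\<rho> k). ennreal \<bar>g y\<bar> \<partial>lebesgue)"
      by (intro nn_integral_cmult) measurable
    also have "\<dots> \<le> ennreal ((\<rho> k / 2) powr - \<sigma>) * ennreal (J k)"
      using J by (intro mult_left_mono) auto
    finally show "(\<integral>\<^sup>+y. ?h k y \<partial>lebesgue) \<le> ennreal ((\<rho> k / 2) powr - \<sigma> * J k)"
      by (simp add: ennreal_mult')
  qed auto
  finally show ?thesis .
qed

lemma powr_power_swap: "0 < (a::real) \<Longrightarrow> (a ^ k) powr q = (a powr q) ^ k"
  by (simp add: powr_powr mult.commute flip: powr_realpow)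

lemma ex_dyadic_shell_inside:
  fixes t \<delta> :: real
  assumes "0 < t" "t < \<delta>"
  shows "\<exists>k. \<delta> / 2 ^ k / 2 \<le> t \<and> t < \<delta> / 2 ^ k"
proof -
  obtain k0 where k0: "\<delta> / t < 2 ^ k0" using real_arch_pow[of 2 "\<delta> / t"] by auto
  define k where "k = (LEAST k. \<delta> / 2 ^ k \<le> t)"
  have ex: "\<delta> / 2 ^ k0 \<le> t" using k0 assms by (simp add: field_simps)
  have k: "\<delta> / 2 ^ k \<le> t" unfolding k_def using ex by (rule LeastI)
  then have "k \<noteq> 0" using assms by (intro notI) simp
  then obtain j where j: "k = Suc j" using not0_implies_Suc by blast
  then have "\<not> \<delta> / 2 ^ j \<le> t" unfolding k_def using not_less_Least[of j] by (metis lessI)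
  then show ?thesis using k j by (intro exI[of _ j]) (simp add: mult.commute)
qed

lemma ex_dyadic_shell_outside:
  fixes t \<delta> :: real
  assumes "0 < \<delta>" "\<delta> \<le> t"
  shows "\<exists>k. \<delta> * 2 ^ Suc k / 2 \<le> t \<and> t < \<delta> * 2 ^ Suc k"
proof -
  obtain k0 where k0: "t / \<delta> < 2 ^ k0" using real_arch_pow[of 2 "t / \<delta>"] by auto
  define k where "k = (LEAST k. t < \<delta> * 2 ^ k)"
  have ex: "t < \<delta> * 2 ^ k0" using k0 assms by (simp add: field_simps)
  have k: "t < \<delta> * 2 ^ k" unfolding k_def using ex by (rule LeastI)
  then have "k \<noteq> 0" using assms by (intro notI) simp
  then obtain j where j: "k = Suc j" using not0_implies_Suc by blast
  then have "\<not> t < \<delta> * 2 ^ j" unfolding k_def using not_less_Least[of j] by (metis lessI)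
  then show ?thesis using k j by (intro exI[of _ j]) simp
qed

lemma suminf_geometric_ennreal:
  assumes "0 \<le> c" "0 \<le> q" "q < 1"
  shows "(\<Sum>k. ennreal (c * q ^ k)) = ennreal (c / (1 - q))"
  using sums_mult[OF geometric_sums[of q], of c] assms
  by (intro suminf_ennreal_eq) auto

text \<open>If mass grows faster than the kernel blows up, the shells shrinking to \<open>x\<close> form a convergent
  geometric series. The two estimates after this one treat slower growth, where the shells going to
  infinity converge, and the critical exponent, where every shell contributes the same amount.\<close>

lemma abs_potential_near:
  fixes g :: "real ^ 'n::finite \<Rightarrow> real"
  assumes g: "g \<in> borel_measurable lebesgue" and \<sigma>: "0 < \<sigma>" "\<sigma> < \<tau>" and \<delta>: "0 < \<delta>" and D: "0 \<le> D"
    and J: "\<And>r. 0 < r \<Longrightarrow> (\<integral>\<^sup>+y\<in>ball x r. ennreal \<bar>g y\<bar> \<partial>lebesgue) \<le> ennreal (D * r powr \<tau>)"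
  shows "abs_potential \<sigma> g (ball x \<delta>) x
           \<le> ennreal (2 powr \<sigma> / (1 - 2 powr - (\<tau> - \<sigma>)) * D * \<delta> powr (\<tau> - \<sigma>))"
proof -
  have "abs_potential \<sigma> g (ball x \<delta>) x \<le> (\<Sum>k. ennreal ((\<delta> / 2 ^ k / 2) powr - \<sigma> * (D * (\<delta> / 2 ^ k) powr \<tau>)))"
  proof (rule abs_potential_le_shells[OF g \<sigma>(1)])
    show "\<exists>k. \<delta> / 2 ^ k / 2 \<le> norm (x - y) \<and> norm (x - y) < \<delta> / 2 ^ k"
      if "y \<in> ball x \<delta>" "y \<noteq> x" for y
      using ex_dyadic_shell_inside[of "norm (x - y)" \<delta>] that by (auto simp: dist_norm)
    show "(\<integral>\<^sup>+y\<in>ball x (\<delta> / 2 ^ k). ennreal \<bar>g y\<bar> \<partial>lebesgue) \<le> ennreal (D * (\<delta> / 2 ^ k) powr \<tau>)" for k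
      using \<delta> by (intro J) simp
  qed
  also have "(\<lambda>k. (\<delta> / 2 ^ k / 2) powr - \<sigma> * (D * (\<delta> / 2 ^ k) powr \<tau>))
      = (\<lambda>k. (2 powr \<sigma> * D * \<delta> powr (\<tau> - \<sigma>)) * (2 powr - (\<tau> - \<sigma>)) ^ k)"
  proof
    fix k :: nat
    have "(\<delta> / 2 ^ k) powr - \<sigma> * (\<delta> / 2 ^ k) powr \<tau> = (\<delta> / 2 ^ k) powr (\<tau> - \<sigma>)"
      by (simp flip: powr_add)
    also have "\<dots> = \<delta> powr (\<tau> - \<sigma>) * (2 powr - (\<tau> - \<sigma>)) ^ k"
      using \<delta> by (simp only: powr_divide powr_power_swap powr_minus) (simp add: field_simps)
    finally have *: "(\<delta> / 2 ^ k) powr - \<sigma> * (\<delta> / 2 ^ k) powr \<tau> = \<dots>" .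
    have "(\<delta> / 2 ^ k / 2) powr - \<sigma> = (\<delta> / 2 ^ k) powr - \<sigma> * 2 powr \<sigma>"
      using \<delta> by (simp add: powr_divide powr_mult powr_minus_divide)
    then show "(\<delta> / 2 ^ k / 2) powr - \<sigma> * (D * (\<delta> / 2 ^ k) powr \<tau>)
      = (2 powr \<sigma> * D * \<delta> powr (\<tau> - \<sigma>)) * (2 powr - (\<tau> - \<sigma>)) ^ k"
      using * by (simp add: mult_ac)
  qed
  also have "(\<Sum>k. ennreal ((2 powr \<sigma> * D * \<delta> powr (\<tau> - \<sigma>)) * (2 powr - (\<tau> - \<sigma>)) ^ k))
      = ennreal (2 powr \<sigma> * D * \<delta> powr (\<tau> - \<sigma>) / (1 - 2 powr - (\<tau> - \<sigma>)))"
    using \<sigma> D powr_less_cancel_iff[of 2 "- (\<tau> - \<sigma>)" 0] by (intro suminf_geometric_ennreal) auto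
  finally show ?thesis by (simp add: mult_ac)
qed

lemma abs_potential_far:
  fixes g :: "real ^ 'n::finite \<Rightarrow> real"
  assumes g: "g \<in> borel_measurable lebesgue" and \<sigma>: "0 < \<sigma>" "\<tau> < \<sigma>" and \<delta>: "0 < \<delta>" and D: "0 \<le> D"
    and J: "\<And>r. 0 < r \<Longrightarrow> (\<integral>\<^sup>+y\<in>ball x r. ennreal \<bar>g y\<bar> \<partial>lebesgue) \<le> ennreal (D * r powr \<tau>)"
  shows "abs_potential \<sigma> g (- ball x \<delta>) x
           \<le> ennreal (2 powr \<tau> / (1 - 2 powr (\<tau> - \<sigma>)) * D * \<delta> powr (\<tau> - \<sigma>))"
proof -
  have "abs_potential \<sigma> g (- ball x \<delta>) x
      \<le> (\<Sum>k. ennreal ((\<delta> * 2 ^ Suc k / 2) powr - \<sigma> * (D * (\<delta> * 2 ^ Suc k) powr \<tau>)))"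
  proof (rule abs_potential_le_shells[OF g \<sigma>(1)])
    show "\<exists>k. \<delta> * 2 ^ Suc k / 2 \<le> norm (x - y) \<and> norm (x - y) < \<delta> * 2 ^ Suc k"
      if "y \<in> - ball x \<delta>" "y \<noteq> x" for y
      using that \<delta> by (intro ex_dyadic_shell_outside) (auto simp: dist_norm)
    show "(\<integral>\<^sup>+y\<in>ball x (\<delta> * 2 ^ Suc k). ennreal \<bar>g y\<bar> \<partial>lebesgue) \<le> ennreal (D * (\<delta> * 2 ^ Suc k) powr \<tau>)" for k
      using \<delta> by (intro J) simp
  qed
  also have "(\<lambda>k. (\<delta> * 2 ^ Suc k / 2) powr - \<sigma> * (D * (\<delta> * 2 ^ Suc k) powr \<tau>))
      = (\<lambda>k. (2 powr \<tau> * D * \<delta> powr (\<tau> - \<sigma>)) * (2 powr (\<tau> - \<sigma>)) ^ k)"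
  proof
    fix k :: nat
    have "(\<delta> * 2 ^ k) powr - \<sigma> * (\<delta> * 2 ^ k) powr \<tau> = (\<delta> * 2 ^ k) powr (\<tau> - \<sigma>)"
      by (simp flip: powr_add)
    also have "\<dots> = \<delta> powr (\<tau> - \<sigma>) * (2 powr (\<tau> - \<sigma>)) ^ k"
      using \<delta> by (simp add: powr_mult powr_power_swap)
    finally have *: "(\<delta> * 2 ^ k) powr - \<sigma> * (\<delta> * 2 ^ k) powr \<tau> = \<dots>" .
    have "(\<delta> * 2 ^ Suc k) powr \<tau> = 2 powr \<tau> * (\<delta> * 2 ^ k) powr \<tau>"
      using \<delta> by (simp add: powr_mult)
    then show "(\<delta> * 2 ^ Suc k / 2) powr - \<sigma> * (D * (\<delta> * 2 ^ Suc k) powr \<tau>)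
      = (2 powr \<tau> * D * \<delta> powr (\<tau> - \<sigma>)) * (2 powr (\<tau> - \<sigma>)) ^ k"
      using * by (simp add: mult_ac)
  qed
  also have "(\<Sum>k. ennreal ((2 powr \<tau> * D * \<delta> powr (\<tau> - \<sigma>)) * (2 powr (\<tau> - \<sigma>)) ^ k))
      = ennreal (2 powr \<tau> * D * \<delta> powr (\<tau> - \<sigma>) / (1 - 2 powr (\<tau> - \<sigma>)))"
    using \<sigma> D powr_less_cancel_iff[of 2 "\<tau> - \<sigma>" 0] by (intro suminf_geometric_ennreal) auto
  finally show ?thesis by (simp add: mult_ac)
qed

lemma abs_potential_annulus:
  fixes g :: "real ^ 'n::finite \<Rightarrow> real"
  assumes g: "g \<in> borel_measurable lebesgue" and \<sigma>: "0 < \<sigma>" and \<delta>: "0 < \<delta>" and D: "0 \<le> D"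
    and J: "\<And>r. 0 < r \<Longrightarrow> (\<integral>\<^sup>+y\<in>ball x r. ennreal \<bar>g y\<bar> \<partial>lebesgue) \<le> ennreal (D * r powr \<sigma>)"
  shows "abs_potential \<sigma> g (ball x (\<delta> * 2 ^ N) - ball x \<delta>) x \<le> ennreal (2 powr \<sigma> * D * real N)"
proof -
  \<comment> \<open>The radius \<open>0\<close> beyond \<open>N\<close> gives empty shells and so cuts the series down to a finite sum.\<close>
  define \<rho> where "\<rho> k = (if k < N then \<delta> * 2 ^ Suc k else 0)" for k :: nat
  have "abs_potential \<sigma> g (ball x (\<delta> * 2 ^ N) - ball x \<delta>) x
      \<le> (\<Sum>k. ennreal ((\<rho> k / 2) powr - \<sigma> * (D * \<rho> k powr \<sigma>)))"
  proof (rule abs_potential_le_shells[OF g \<sigma>])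
    show "\<exists>k. \<rho> k / 2 \<le> norm (x - y) \<and> norm (x - y) < \<rho> k"
      if y: "y \<in> ball x (\<delta> * 2 ^ N) - ball x \<delta>" "y \<noteq> x" for y
    proof -
      obtain k where k: "\<delta> * 2 ^ Suc k / 2 \<le> norm (x - y)" "norm (x - y) < \<delta> * 2 ^ Suc k"
        using ex_dyadic_shell_outside[of \<delta> "norm (x - y)"] y \<delta> by (auto simp: dist_norm)
      have "\<delta> * 2 ^ k < \<delta> * 2 ^ N" using k y by (simp add: dist_norm)
      then have "k < N" using \<delta> by simp
      then show ?thesis using k by (intro exI[of _ k]) (simp add: \<rho>_def)
    qed
    show "(\<integral>\<^sup>+y\<in>ball x (\<rho> k). ennreal \<bar>g y\<bar> \<partial>lebesgue) \<le> ennreal (D * \<rho> k powr \<sigma>)" for k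
      using J[of "\<rho> k"] \<delta> by (cases "k < N") (auto simp: \<rho>_def)
  qed
  also have "\<dots> = (\<Sum>k<N. ennreal ((\<rho> k / 2) powr - \<sigma> * (D * \<rho> k powr \<sigma>)))"
    by (rule suminf_finite) (auto simp: \<rho>_def)
  also have "\<dots> = (\<Sum>k<N. ennreal (2 powr \<sigma> * D))"
  proof (rule sum.cong)
    fix k assume "k \<in> {..<N}"
    then have "0 < \<rho> k" using \<delta> by (simp add: \<rho>_def)
    then have "(\<rho> k / 2) powr - \<sigma> * \<rho> k powr \<sigma> = 2 powr \<sigma>"
      by (simp add: powr_divide powr_minus_divide)
    then show "ennreal ((\<rho> k / 2) powr - \<sigma> * (D * \<rho> k powr \<sigma>)) = ennreal (2 powr \<sigma> * D)"
      by (simp add: mult_ac)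
  qed simp
  also have "\<dots> = ennreal (2 powr \<sigma> * D * real N)"
    using D by (subst sum_ennreal) (auto simp: mult_ac)
  finally show ?thesis .
qed

section \<open>Potentials at light points\<close>

text \<open>The mass distribution \<open>\<bar>g\<bar>\<^sup>p dy\<close>, whose heavy points are the exceptional set for the potential of \<open>g\<close>.\<close>

definition power_measure :: "real \<Rightarrow> (real ^ 'n \<Rightarrow> real) \<Rightarrow> (real ^ 'n) measure" where
  "power_measure p g = density lebesgue (\<lambda>y. ennreal (\<bar>g y\<bar> powr p))"

lemma sets_power_measure: "sets borel \<subseteq> sets (power_measure p g)"
  by (auto simp: power_measure_def)

lemma emeasure_power_measure:
  fixes g :: "real ^ 'n::finite \<Rightarrow> real"
  assumes "g \<in> borel_measurable lebesgue" "A \<in> sets lebesgue"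
  shows "emeasure (power_measure p g) A = (\<integral>\<^sup>+y\<in>A. ennreal (\<bar>g y\<bar> powr p) \<partial>lebesgue)"
proof -
  note [measurable] = assms
  show ?thesis unfolding power_measure_def by (rule emeasure_density) measurable
qed

text \<open>One constant that serves all shells around a light point: the geometric series of the small shells,
  and \<open>2\<^sup>\<sigma> (1 + \<omega>\<^sub>n)\<close> for each of the others.\<close>

definition shell_const :: "nat \<Rightarrow> real \<Rightarrow> real \<Rightarrow> real" where
  "shell_const n \<sigma> \<eta> = 2 powr \<sigma> * (1 + unit_ball_vol (real n)) / (1 - 2 powr - \<eta>)"

lemma two_powr_minus_less_1: "0 < \<eta> \<Longrightarrow> 2 powr - \<eta> < (1::real)"
  using powr_less_cancel_iff[of 2 "- \<eta>" 0] by simp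

lemma shell_const_pos: "0 < \<eta> \<Longrightarrow> 0 < shell_const n \<sigma> \<eta>"
  unfolding shell_const_def using two_powr_minus_less_1[of \<eta>] unit_ball_vol_nonneg[of "real n"]
  by (intro divide_pos_pos mult_pos_pos add_pos_nonneg) auto

text \<open>At a light point the mass in \<open>B(x, r)\<close> is at most of order \<open>r\<^bsup>n-\<alpha>+\<eta>\<^esup>\<close> with \<open>\<eta> > 0\<close>. This surplus is where
  \<open>\<beta> > n - \<alpha>p\<close> enters. The bound tends to \<open>0\<close> with \<open>\<delta>\<close>, uniformly over the light points, which is what
  the continuity of the potential rests on.\<close>

lemma abs_potential_near_light_point:
  fixes g :: "real ^ 'n::finite \<Rightarrow> real" and \<alpha> \<beta> p :: real
  defines "\<eta> \<equiv> (\<beta> - (real CARD('n) - \<alpha> * p)) / p"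
  assumes g: "g \<in> borel_measurable lebesgue" and p: "1 \<le> p" and \<alpha>: "\<alpha> < real CARD('n)"
    and \<beta>: "real CARD('n) - \<alpha> * p < \<beta>" and T: "0 < T" and \<delta>: "0 < \<delta>"
    and x: "x \<notin> heavy_points \<beta> (T powr p) (power_measure p g)"
  shows "abs_potential (real CARD('n) - \<alpha>) g (ball x \<delta>) x
    \<le> ennreal (shell_const CARD('n) (real CARD('n) - \<alpha>) (\<eta>) * T * \<delta> powr \<eta>)"
proof -
  let ?n = "real CARD('n)" 
  have \<eta>: "0 < \<eta>" using \<beta> p by (simp add: \<eta>_def)
  have e: "?n + (\<beta> - ?n) / p = (?n - \<alpha>) + \<eta>"
    using p by (simp add: \<eta>_def field_simps)
  have J: "(\<integral>\<^sup>+y\<in>ball x r. ennreal \<bar>g y\<bar> \<partial>lebesgue)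
       \<le> ennreal ((1 + unit_ball_vol ?n) * T * r powr ((?n - \<alpha>) + \<eta>))" if r: "0 < r" for r
  proof -
    have "\<not> ennreal (T powr p * r powr \<beta>) < emeasure (power_measure p g) (ball x r)"
      using x r by (auto simp: heavy_points_def)
    then have "(\<integral>\<^sup>+y\<in>ball x r. ennreal (\<bar>g y\<bar> powr p) \<partial>lebesgue) \<le> ennreal (T powr p * r powr \<beta>)"
      by (simp add: emeasure_power_measure[OF g lebesgue_ball_sets] not_less)
    from nn_integral_ball_le_of_powr[OF g p T r this] show ?thesis unfolding e .
  qed
  have "abs_potential (?n - \<alpha>) g (ball x \<delta>) x
    \<le> ennreal (2 powr (?n - \<alpha>) / (1 - 2 powr - ((?n - \<alpha>) + \<eta> - (?n - \<alpha>))) *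
          ((1 + unit_ball_vol ?n) * T) * \<delta> powr ((?n - \<alpha>) + \<eta> - (?n - \<alpha>)))"
    using \<alpha> \<eta> \<delta> T unit_ball_vol_nonneg[of ?n] J by (intro abs_potential_near[OF g]) auto
  then show ?thesis by (simp add: shell_const_def mult_ac)
qed

text \<open>The shells inside radius \<open>\<delta> = R / 2\<^sup>N\<close> are summed by lightness, the \<open>N\<close> shells between \<open>\<delta>\<close> and \<open>R\<close> by
  the growth assumption. The threshold \<open>T = M \<delta>\<^bsup>-\<eta>\<^esup>\<close> makes the inner part comparable to a single
  outer shell. The bound grows only linearly in \<open>N\<close> while \<open>T\<close> grows geometrically.\<close>

lemma abs_potential_light_point:
  fixes g :: "real ^ 'n::finite \<Rightarrow> real" and \<alpha> \<beta> p :: real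
  defines "\<eta> \<equiv> (\<beta> - (real CARD('n) - \<alpha> * p)) / p"
  assumes g: "g \<in> borel_measurable lebesgue" and p: "1 \<le> p" and \<alpha>: "\<alpha> < real CARD('n)"
    and \<beta>: "real CARD('n) - \<alpha> * p < \<beta>" and M: "0 < M" and R: "0 < R"
    and J: "\<And>r. 0 < r \<Longrightarrow> (\<integral>\<^sup>+y\<in>ball x r. ennreal \<bar>g y\<bar> \<partial>lebesgue)
       \<le> ennreal ((1 + unit_ball_vol (real CARD('n))) * M * r powr (real CARD('n) - \<alpha>))"
    and x: "x \<notin> heavy_points \<beta> ((M * (R / 2 ^ N) powr - \<eta>) powr p) (power_measure p g)"
  shows "abs_potential (real CARD('n) - \<alpha>) g (ball x R) x
    \<le> ennreal (shell_const CARD('n) (real CARD('n) - \<alpha>) (\<eta>) * M * (1 + real N))"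
proof -
  let ?\<sigma> = "real CARD('n) - \<alpha>"  and ?\<omega> = "unit_ball_vol (real CARD('n))"
  let ?K = "shell_const CARD('n) ?\<sigma> \<eta>"
  define \<delta> where "\<delta> = R / 2 ^ N"
  have \<delta>: "0 < \<delta>" "R = \<delta> * 2 ^ N" using R by (auto simp: \<delta>_def)
  have \<eta>: "0 < \<eta>" using \<beta> p by (simp add: \<eta>_def)
  note K = shell_const_pos[OF \<eta>, of "CARD('n)" ?\<sigma>]
  have "abs_potential ?\<sigma> g (ball x \<delta>) x \<le> ennreal (?K * (M * \<delta> powr - \<eta>) * \<delta> powr \<eta>)"
    unfolding \<eta>_def
    by (rule abs_potential_near_light_point[OF g p \<alpha> \<beta>])
      (use M \<delta> x in \<open>simp_all flip: \<delta>_def \<eta>_def\<close>)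
  also have "?K * (M * \<delta> powr - \<eta>) * \<delta> powr \<eta> = ?K * M"
    using \<delta> by (simp add: mult.assoc flip: powr_add)
  finally have near: "abs_potential ?\<sigma> g (ball x \<delta>) x \<le> ennreal (?K * M)" .
  have "abs_potential ?\<sigma> g (ball x (\<delta> * 2 ^ N) - ball x \<delta>) x \<le> ennreal (2 powr ?\<sigma> * ((1 + ?\<omega>) * M) * real N)"
    using g \<alpha> \<delta>(1) M J by (intro abs_potential_annulus) auto
  also have "\<dots> \<le> ennreal (?K * M * real N)"
  proof (rule ennreal_leI)
    have "2 powr ?\<sigma> * (1 + ?\<omega>) / 1 \<le> 2 powr ?\<sigma> * (1 + ?\<omega>) / (1 - 2 powr - \<eta>)"
      using two_powr_minus_less_1[OF \<eta>] by (intro divide_left_mono) auto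
    then have "2 powr ?\<sigma> * (1 + ?\<omega>) \<le> ?K" by (simp add: shell_const_def)
    then have "2 powr ?\<sigma> * (1 + ?\<omega>) * (M * real N) \<le> ?K * (M * real N)"
      using M by (intro mult_right_mono) auto
    then show "2 powr ?\<sigma> * ((1 + ?\<omega>) * M) * real N \<le> ?K * M * real N" by (simp add: mult_ac)
  qed
  finally have mid: "abs_potential ?\<sigma> g (ball x R - ball x \<delta>) x \<le> ennreal (?K * M * real N)"
    unfolding \<delta>(2) .
  have "\<delta> \<le> R" using R by (simp add: \<delta>_def divide_le_eq)
  then have "ball x R = ball x \<delta> \<union> (ball x R - ball x \<delta>)"
    using subset_ball[of \<delta> R x] by blast
  then have "abs_potential ?\<sigma> g (ball x R) x
      \<le> abs_potential ?\<sigma> g (ball x \<delta>) x + abs_potential ?\<sigma> g (ball x R - ball x \<delta>) x"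
    using abs_potential_Un_le[OF g, of "ball x \<delta>" "ball x R - ball x \<delta>" ?\<sigma> x] by simp
  also have "\<dots> \<le> ennreal (?K * M) + ennreal (?K * M * real N)"
    by (rule add_mono[OF near mid])
  also have "\<dots> = ennreal (?K * M * (1 + real N))"
    using K M by (subst ennreal_plus[symmetric]) (auto simp: algebra_simps)
  finally show ?thesis .
qed

lemma hausdorff_content_heavy_points_power_measure:
  fixes g :: "real ^ 'n::finite \<Rightarrow> real"
  assumes g: "g \<in> borel_measurable lebesgue" and T: "0 < T" and \<beta>: "0 < \<beta>" and "0 \<le> m"
    and m: "(\<integral>\<^sup>+y. ennreal (\<bar>g y\<bar> powr p) \<partial>lebesgue) \<le> ennreal m"
  shows "hausdorff_content \<beta> (heavy_points \<beta> (T powr p) (power_measure p g))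
    \<le> ennreal (unit_ball_vol \<beta> * 5 powr \<beta> / T powr p * m)"
proof (rule hausdorff_content_heavy_points[OF sets_power_measure])
  have "emeasure (power_measure p g) UNIV \<le> ennreal m"
    using emeasure_power_measure[OF g, of UNIV p] m by simp
  then show "emeasure (power_measure p g) (space (power_measure p g)) \<le> ennreal m"
    by (simp add: power_measure_def)
qed (use assms in auto)

lemma riesz_kernel_eq:
  "riesz_kernel \<alpha> g x y = g y * norm (x - y) powr - (real CARD('n) - \<alpha>)"
  for x :: "real ^ 'n::finite"
  by (simp only: riesz_kernel_def powr_minus_divide) simp

lemma borel_measurable_riesz_kernel:
  fixes g :: "real ^ 'n::finite \<Rightarrow> real"
  assumes [measurable]: "g \<in> borel_measurable lebesgue"
  shows "riesz_kernel \<alpha> g x \<in> borel_measurable lebesgue"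
proof -
  have [measurable]: "(\<lambda>y. norm (x - y) powr - (real CARD('n) - \<alpha>)) \<in> borel_measurable lebesgue"
    by (rule borel_measurable_lebesgue_of_borel) measurable
  show ?thesis unfolding riesz_kernel_eq[abs_def] by measurable
qed

lemma nn_integral_riesz_kernel:
  fixes g :: "real ^ 'n::finite \<Rightarrow> real"
  shows "(\<integral>\<^sup>+y. ennreal (norm (riesz_kernel \<alpha> g x y)) \<partial>lebesgue)
           = abs_potential (real CARD('n) - \<alpha>) g UNIV x"
  unfolding abs_potential_def riesz_kernel_eq
  by (intro nn_integral_cong) (simp add: abs_mult)

lemma integrable_riesz_kernel_iff:
  fixes g :: "real ^ 'n::finite \<Rightarrow> real"
  assumes "g \<in> borel_measurable lebesgue"
  shows "integrable lebesgue (riesz_kernel \<alpha> g x) \<longleftrightarrow> abs_potential (real CARD('n) - \<alpha>) g UNIV x < \<infinity>"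
  unfolding integrable_iff_bounded nn_integral_riesz_kernel
  using borel_measurable_riesz_kernel[OF assms] by simp

lemma abs_LINT_le_of_nn_integral:
  fixes h :: "'a \<Rightarrow> real"
  assumes "integrable M h" "(\<integral>\<^sup>+y. ennreal \<bar>h y\<bar> \<partial>M) \<le> ennreal b" "0 \<le> b"
  shows "\<bar>LINT y|M. h y\<bar> \<le> b"
proof -
  have "ennreal \<bar>LINT y|M. h y\<bar> \<le> (\<integral>\<^sup>+y. ennreal \<bar>h y\<bar> \<partial>M)"
    using integral_norm_bound_ennreal[OF assms(1)] by simp
  also have "\<dots> \<le> ennreal b" by fact
  finally show ?thesis using assms(3) by simp
qed

text \<open>Inside \<open>B(x, 1)\<close> lightness makes the integral converge; outside, the kernel is at most \<open>1\<close>.\<close>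

lemma integrable_riesz_kernel_light_point:
  fixes g :: "real ^ 'n::finite \<Rightarrow> real"
  assumes g: "integrable lebesgue g" and p: "1 \<le> p" and \<alpha>: "\<alpha> < real CARD('n)"
    and \<beta>: "real CARD('n) - \<alpha> * p < \<beta>" and T: "0 < T"
    and x: "x \<notin> heavy_points \<beta> (T powr p) (power_measure p g)"
  shows "integrable lebesgue (riesz_kernel \<alpha> g x)"
proof -
  have gm[measurable]: "g \<in> borel_measurable lebesgue" using g by simp
  let ?\<sigma> = "real CARD('n) - \<alpha>"
  have "abs_potential ?\<sigma> g (- ball x 1) x \<le> (\<integral>\<^sup>+y. ennreal (norm (g y)) \<partial>lebesgue)"
    unfolding abs_potential_def
  proof (rule nn_integral_mono)
    fix y
    show "ennreal (\<bar>g y\<bar> * norm (x - y) powr - ?\<sigma>) * indicator (- ball x 1) y \<le> ennreal (norm (g y))"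
    proof (cases "y \<in> ball x 1")
      case False
      then have "norm (x - y) powr - ?\<sigma> \<le> 1 powr - ?\<sigma>"
        using \<alpha> by (intro powr_mono2') (auto simp: dist_norm)
      then have "\<bar>g y\<bar> * norm (x - y) powr - ?\<sigma> \<le> \<bar>g y\<bar> * 1" by (intro mult_left_mono) auto
      then have "ennreal (\<bar>g y\<bar> * norm (x - y) powr - ?\<sigma>) \<le> ennreal (norm (g y))"
        by (intro ennreal_leI) simp
      then show ?thesis using False by simp
    qed auto
  qed
  also have "\<dots> < \<infinity>" using g by (simp add: integrable_iff_bounded)
  finally have far: "abs_potential ?\<sigma> g (- ball x 1) x < \<infinity>" .
  have near: "abs_potential ?\<sigma> g (ball x 1) x < \<infinity>"
    using abs_potential_near_light_point[OF gm p \<alpha> \<beta> T zero_less_one x]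
    by (rule order_le_less_trans) simp
  have "ball x 1 \<union> - ball x 1 = UNIV" by blast
  then have "abs_potential ?\<sigma> g UNIV x \<le> abs_potential ?\<sigma> g (ball x 1) x + abs_potential ?\<sigma> g (- ball x 1) x"
    using abs_potential_Un_le[OF gm, of "ball x 1" "- ball x 1" ?\<sigma> x] by simp
  also have "\<dots> < \<infinity>" using near far by simp
  finally show ?thesis using integrable_riesz_kernel_iff[OF gm] by simp
qed

lemma integrable_bounded_kernel:
  fixes g :: "real ^ 'n::finite \<Rightarrow> real"
  assumes g: "integrable lebesgue g" and \<sigma>: "0 < \<sigma>" and \<delta>: "0 < \<delta>"
  shows "integrable lebesgue (\<lambda>y. g y * max \<delta> (norm (x - y)) powr - \<sigma>)"
proof (rule Bochner_Integration.integrable_bound)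
  have [measurable]: "g \<in> borel_measurable lebesgue" using g by simp
  have [measurable]: "(\<lambda>y. max \<delta> (norm (x - y)) powr - \<sigma>) \<in> borel_measurable lebesgue"
    by (rule borel_measurable_lebesgue_of_borel) measurable
  show "(\<lambda>y. g y * max \<delta> (norm (x - y)) powr - \<sigma>) \<in> borel_measurable lebesgue" by measurable
  show "integrable lebesgue (\<lambda>y. g y * \<delta> powr - \<sigma>)" using g by simp
  have "max \<delta> (norm (x - y)) powr - \<sigma> \<le> \<delta> powr - \<sigma>" for y
    using \<sigma> \<delta> by (intro powr_mono2') auto
  then show "AE y in lebesgue. norm (g y * max \<delta> (norm (x - y)) powr - \<sigma>) \<le> norm (g y * \<delta> powr - \<sigma>)"
    by (auto simp: abs_mult intro!: mult_left_mono)
qed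

lemma continuous_on_bounded_kernel:
  fixes g :: "real ^ 'n::finite \<Rightarrow> real"
  assumes g: "integrable lebesgue g" and \<sigma>: "0 < \<sigma>" and \<delta>: "0 < \<delta>"
  shows "continuous_on A (\<lambda>x. LINT y|lebesgue. g y * max \<delta> (norm (x - y)) powr - \<sigma>)"
proof (rule continuous_on_sequentiallyI)
  fix u :: "nat \<Rightarrow> real ^ 'n" and a assume u: "u \<longlonglongrightarrow> a"
  have meas: "(\<lambda>y. g y * max \<delta> (norm (x - y)) powr - \<sigma>) \<in> borel_measurable lebesgue" for x
    using integrable_bounded_kernel[OF assms] by (rule borel_measurable_integrable)
  have "max \<delta> (norm (x - y)) powr - \<sigma> \<le> \<delta> powr - \<sigma>" for x y :: "real ^ 'n"
    using \<sigma> \<delta> by (intro powr_mono2') auto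
  then have bnd: "norm (g y * max \<delta> (norm (x - y)) powr - \<sigma>) \<le> \<bar>g y\<bar> * \<delta> powr - \<sigma>" for x y
    by (auto simp: abs_mult intro!: mult_left_mono)
  have lim: "(\<lambda>k. g y * max \<delta> (norm (u k - y)) powr - \<sigma>) \<longlonglongrightarrow> g y * max \<delta> (norm (a - y)) powr - \<sigma>" for y
    using \<delta> by (intro tendsto_intros u) auto
  show "(\<lambda>k. LINT y|lebesgue. g y * max \<delta> (norm (u k - y)) powr - \<sigma>)
          \<longlonglongrightarrow> (LINT y|lebesgue. g y * max \<delta> (norm (a - y)) powr - \<sigma>)"
    by (rule integral_dominated_convergence[where w = "\<lambda>y. \<bar>g y\<bar> * \<delta> powr - \<sigma>"])
      (use meas bnd lim g in auto)
qed

text \<open>Replacing \<open>\<bar>x - y\<bar>\<close> by \<open>max \<delta> \<bar>x - y\<bar>\<close> gives a continuous function of \<open>x\<close>, because the kernel is then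
  bounded. The error is at most the potential of the mass in \<open>B(x, \<delta>)\<close>, which tends to \<open>0\<close> uniformly
  over light points, so the potential is a uniform limit of continuous functions there.\<close>

lemma continuous_on_light_points:
  fixes g :: "real ^ 'n::finite \<Rightarrow> real"
  assumes g: "integrable lebesgue g" and p: "1 \<le> p" and \<alpha>: "\<alpha> < real CARD('n)"
    and \<beta>: "real CARD('n) - \<alpha> * p < \<beta>" and T: "0 < T"
  shows "continuous_on (- heavy_points \<beta> (T powr p) (power_measure p g))
           (\<lambda>x. LINT y|lebesgue. riesz_kernel \<alpha> g x y)"
proof -
  let ?\<sigma> = "real CARD('n) - \<alpha>" and ?S = "- heavy_points \<beta> (T powr p) (power_measure p g)"
  let ?F = "\<lambda>\<delta> x. LINT y|lebesgue. g y * max \<delta> (norm (x - y)) powr - ?\<sigma>"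
  define \<eta> where "\<eta> = (\<beta> - (real CARD('n) - \<alpha> * p)) / p"
  define K where "K = shell_const CARD('n) ?\<sigma> \<eta> * T"
  have \<eta>: "0 < \<eta>" using \<beta> p by (simp add: \<eta>_def)
  have K: "0 < K" using shell_const_pos[OF \<eta>] T by (simp add: K_def)
  have gm: "g \<in> borel_measurable lebesgue" using g by simp
  have \<sigma>: "0 < ?\<sigma>" using \<alpha> by simp
  have close: "dist (?F \<delta> x) (LINT y|lebesgue. riesz_kernel \<alpha> g x y) \<le> K * \<delta> powr \<eta>"
    if x: "x \<in> ?S" and \<delta>: "0 < \<delta>" for x \<delta>
  proof -
    have x': "x \<notin> heavy_points \<beta> (T powr p) (power_measure p g)" using x by simp
    note i1 = integrable_bounded_kernel[OF g \<sigma> \<delta>, of x]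
    note i2 = integrable_riesz_kernel_light_point[OF g p \<alpha> \<beta> T x']
    let ?h = "\<lambda>y. g y * max \<delta> (norm (x - y)) powr - ?\<sigma> - riesz_kernel \<alpha> g x y"
    have "(\<integral>\<^sup>+y. ennreal \<bar>?h y\<bar> \<partial>lebesgue) \<le> abs_potential ?\<sigma> g (ball x \<delta>) x"
      unfolding abs_potential_def
    proof (rule nn_integral_mono_AE)
      \<comment> \<open>At \<open>y = x\<close> the kernel takes the value \<open>0\<close>, so the pointwise bound fails there.\<close>
      have "AE y in lebesgue. y \<noteq> x"
        by (rule AE_completion) (rule AE_lborel_singleton)
      then show "AE y in lebesgue. ennreal \<bar>?h y\<bar>
          \<le> ennreal (\<bar>g y\<bar> * norm (x - y) powr - ?\<sigma>) * indicator (ball x \<delta>) y"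
      proof eventually_elim
        case (elim y)
        show ?case
        proof (cases "y \<in> ball x \<delta>")
          case True
          then have n: "norm (x - y) < \<delta>" by (simp add: dist_norm)
          then have "\<delta> powr - ?\<sigma> \<le> norm (x - y) powr - ?\<sigma>"
            using elim \<sigma> by (intro powr_mono2') auto
          then have "\<bar>\<delta> powr - ?\<sigma> - norm (x - y) powr - ?\<sigma>\<bar> \<le> norm (x - y) powr - ?\<sigma>"
            using powr_ge_zero[of \<delta> "- ?\<sigma>"] by linarith
          then have "\<bar>g y\<bar> * \<bar>\<delta> powr - ?\<sigma> - norm (x - y) powr - ?\<sigma>\<bar> \<le> \<bar>g y\<bar> * norm (x - y) powr - ?\<sigma>"
            by (rule mult_left_mono) simp
          moreover have "?h y = g y * (\<delta> powr - ?\<sigma> - norm (x - y) powr - ?\<sigma>)"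
            using n by (simp add: riesz_kernel_eq max_def right_diff_distrib)
          ultimately have "\<bar>?h y\<bar> \<le> \<bar>g y\<bar> * norm (x - y) powr - ?\<sigma>" by (simp add: abs_mult)
          then have "ennreal \<bar>?h y\<bar> \<le> ennreal (\<bar>g y\<bar> * norm (x - y) powr - ?\<sigma>)" by (rule ennreal_leI)
          then show ?thesis using True by simp
        next
          case False
          then show ?thesis by (simp add: riesz_kernel_eq dist_norm max_def)
        qed
      qed
    qed
    also have "\<dots> \<le> ennreal (K * \<delta> powr \<eta>)"
      using abs_potential_near_light_point[OF gm p \<alpha> \<beta> T \<delta> x'] by (simp add: K_def \<eta>_def)
    finally have "\<bar>LINT y|lebesgue. ?h y\<bar> \<le> K * \<delta> powr \<eta>"
      using i1 i2 K by (intro abs_LINT_le_of_nn_integral) auto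
    then show ?thesis using i1 i2 by (simp add: dist_real_def)
  qed
  have "uniform_limit ?S ?F (\<lambda>x. LINT y|lebesgue. riesz_kernel \<alpha> g x y) (at_right 0)"
  proof (rule uniform_limitI)
    fix e :: real assume e: "0 < e"
    have "((\<lambda>\<delta>::real. \<delta> powr \<eta>) \<longlongrightarrow> 0 powr \<eta>) (at_right 0)"
      using \<eta> by (intro tendsto_powr' tendsto_ident_at tendsto_const)
        (auto intro: eventually_mono[OF eventually_at_right_less])
    then have "((\<lambda>\<delta>. K * \<delta> powr \<eta>) \<longlongrightarrow> K * 0) (at_right 0)"
      by (intro tendsto_mult tendsto_const) simp
    then have "eventually (\<lambda>\<delta>. K * \<delta> powr \<eta> < e) (at_right 0)"
      using e by (intro order_tendstoD(2)) auto
    then show "\<forall>\<^sub>F \<delta> in at_right 0. \<forall>x\<in>?S. dist (?F \<delta> x) (LINT y|lebesgue. riesz_kernel \<alpha> g x y) < e"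
      using eventually_at_right_less[of 0]
      by eventually_elim (use close in \<open>fastforce intro: order_le_less_trans\<close>)
  qed
  moreover have "\<forall>\<^sub>F \<delta> in at_right 0. continuous_on ?S (?F \<delta>)"
    using eventually_at_right_less[of 0]
    by eventually_elim (rule continuous_on_bounded_kernel[OF g \<sigma>])
  ultimately show ?thesis by (intro uniform_limit_theorem) auto
qed

section \<open>Potentials of distant mass\<close>

lemma abs_diff_powr_minus_le:
  fixes a b m \<sigma> :: real
  assumes m: "0 < m" "m \<le> a" "m \<le> b" and \<sigma>: "0 < \<sigma>"
  shows "\<bar>a powr - \<sigma> - b powr - \<sigma>\<bar> \<le> \<sigma> * m powr - (\<sigma> + 1) * \<bar>a - b\<bar>"
proof -
  have "norm (a powr - \<sigma> - b powr - \<sigma>) \<le> \<sigma> * m powr - (\<sigma> + 1) * norm (a - b)"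
  proof (rule field_differentiable_bound[of "{m..}" _ "\<lambda>t. - \<sigma> * t powr (- \<sigma> - 1)"])
    fix t assume t: "t \<in> {m..}"
    then have "0 < t" using m by simp
    then show "((\<lambda>t. t powr - \<sigma>) has_field_derivative - \<sigma> * t powr (- \<sigma> - 1)) (at t within {m..})"
      by (auto intro!: derivative_eq_intros)
    have "t powr (- \<sigma> - 1) \<le> m powr (- \<sigma> - 1)" using t m \<sigma> by (intro powr_mono2') auto
    then show "norm (- \<sigma> * t powr (- \<sigma> - 1)) \<le> \<sigma> * m powr - (\<sigma> + 1)"
      using \<sigma> by (simp add: abs_mult)
  qed (use m in auto)
  then show ?thesis by simp
qed

lemma half_powr_minus: "0 \<le> t \<Longrightarrow> (t / 2) powr - \<sigma> = 2 powr \<sigma> * t powr - \<sigma>" for t \<sigma> :: real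
  by (simp add: powr_divide powr_minus_divide)

lemma norm_diff_ge_half_norm:
  fixes x y z :: "'a::real_normed_vector"
  assumes "x \<in> ball z d" "y \<notin> ball z (2 * d)"
  shows "norm (z - y) / 2 \<le> norm (x - y)"
  using assms norm_triangle_ineq[of "z - x" "x - y"] by (simp add: dist_norm)

text \<open>For \<open>\<bar>x - z\<bar> < d\<close> and \<open>\<bar>y - z\<bar> \<ge> 2d\<close>, the distances from \<open>y\<close> to \<open>x\<close> and to \<open>z\<close> are comparable. Hence
  convergence of the distant potential at the single point \<open>z\<close> propagates to the whole ball and
  provides an integrable majorant.\<close>

lemma distant_kernel_le:
  fixes h :: "real ^ 'n::finite \<Rightarrow> real"
  assumes \<alpha>: "\<alpha> < real CARD('n)" and h: "\<And>y. y \<in> ball z (2 * d) \<Longrightarrow> h y = 0" and x: "x \<in> ball z d"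
  shows "norm (riesz_kernel \<alpha> h x y) \<le> 2 powr (real CARD('n) - \<alpha>) * norm (riesz_kernel \<alpha> h z y)"
proof (cases "y \<in> ball z (2 * d)")
  case False
  have d: "0 < d" using x by (metis ball_eq_empty emptyE not_le)
  then have "0 < norm (z - y)" using False by auto
  then have "norm (x - y) powr - (real CARD('n) - \<alpha>) \<le> (norm (z - y) / 2) powr - (real CARD('n) - \<alpha>)"
    using norm_diff_ge_half_norm[OF x False] \<alpha> by (intro powr_mono2') auto
  also have "\<dots> = 2 powr (real CARD('n) - \<alpha>) * norm (z - y) powr - (real CARD('n) - \<alpha>)"
    by (rule half_powr_minus) simp
  finally have "\<bar>h y\<bar> * norm (x - y) powr - (real CARD('n) - \<alpha>)
      \<le> \<bar>h y\<bar> * (2 powr (real CARD('n) - \<alpha>) * norm (z - y) powr - (real CARD('n) - \<alpha>))"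
    by (rule mult_left_mono) simp
  then show ?thesis by (simp add: riesz_kernel_eq abs_mult mult_ac)
qed (simp add: h riesz_kernel_eq)

lemma integrable_distant_kernel:
  fixes h :: "real ^ 'n::finite \<Rightarrow> real"
  assumes hm: "h \<in> borel_measurable lebesgue" and \<alpha>: "\<alpha> < real CARD('n)"
    and h: "\<And>y. y \<in> ball z (2 * d) \<Longrightarrow> h y = 0"
    and z: "integrable lebesgue (riesz_kernel \<alpha> h z)" and x: "x \<in> ball z d"
  shows "integrable lebesgue (riesz_kernel \<alpha> h x)"
proof (rule Bochner_Integration.integrable_bound)
  show "integrable lebesgue (\<lambda>y. 2 powr (real CARD('n) - \<alpha>) * norm (riesz_kernel \<alpha> h z y))"
    using z by simp
  show "riesz_kernel \<alpha> h x \<in> borel_measurable lebesgue" by (rule borel_measurable_riesz_kernel[OF hm])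
  show "AE y in lebesgue. norm (riesz_kernel \<alpha> h x y)
     \<le> norm (2 powr (real CARD('n) - \<alpha>) * norm (riesz_kernel \<alpha> h z y))"
    using distant_kernel_le[OF \<alpha> h x] by (intro AE_I2) (simp add: abs_mult)
qed

lemma continuous_on_distant_potential:
  fixes h :: "real ^ 'n::finite \<Rightarrow> real"
  assumes hm: "h \<in> borel_measurable lebesgue" and \<alpha>: "\<alpha> < real CARD('n)"
    and h: "\<And>y. y \<in> ball z (2 * d) \<Longrightarrow> h y = 0"
    and z: "integrable lebesgue (riesz_kernel \<alpha> h z)"
  shows "continuous_on (ball z d) (\<lambda>x. LINT y|lebesgue. riesz_kernel \<alpha> h x y)"
proof (rule continuous_on_sequentiallyI)
  fix u :: "nat \<Rightarrow> real ^ 'n" and a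
  assume u: "\<forall>k. u k \<in> ball z d" "a \<in> ball z d" "u \<longlonglongrightarrow> a"
  have lim: "(\<lambda>k. riesz_kernel \<alpha> h (u k) y) \<longlonglongrightarrow> riesz_kernel \<alpha> h a y" for y
  proof (cases "y \<in> ball z (2 * d)")
    case True
    then show ?thesis by (simp add: h riesz_kernel_eq)
  next
    case False
    have "0 < d" using u(2) by (metis ball_eq_empty emptyE not_le)
    then have "a \<noteq> y" using False u(2) by auto
    then show ?thesis unfolding riesz_kernel_eq by (intro tendsto_intros u) auto
  qed
  show "(\<lambda>k. LINT y|lebesgue. riesz_kernel \<alpha> h (u k) y) \<longlonglongrightarrow> (LINT y|lebesgue. riesz_kernel \<alpha> h a y)"
  proof (rule integral_dominated_convergence)
    show "integrable lebesgue (\<lambda>y. 2 powr (real CARD('n) - \<alpha>) * norm (riesz_kernel \<alpha> h z y))"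
      using z by simp
    show "AE y in lebesgue. norm (riesz_kernel \<alpha> h (u k) y)
       \<le> 2 powr (real CARD('n) - \<alpha>) * norm (riesz_kernel \<alpha> h z y)" for k
      by (intro AE_I2 distant_kernel_le[OF \<alpha>]) (use u h in auto)
  qed (use lim in \<open>simp_all add: borel_measurable_riesz_kernel[OF hm]\<close>)
qed

text \<open>By the mean value theorem, moving the evaluation point by at most \<open>d\<close> changes the kernel by at most
  a multiple of \<open>d \<bar>z - y\<bar>\<^bsup>-(n-\<alpha>)-1\<^esup>\<close>. The extra power makes the shells outside radius \<open>2d\<close> summable, with a
  sum of order \<open>D / d\<close>, so the oscillation does not depend on \<open>d\<close>.\<close>

lemma distant_potential_oscillation:
  fixes h :: "real ^ 'n::finite \<Rightarrow> real"
  assumes hm: "h \<in> borel_measurable lebesgue" and \<alpha>: "\<alpha> < real CARD('n)"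
    and h: "\<And>y. y \<in> ball z (2 * d) \<Longrightarrow> h y = 0"
    and z: "integrable lebesgue (riesz_kernel \<alpha> h z)" and x: "x \<in> ball z d"
    and D: "0 \<le> D"
    and J: "\<And>r. 0 < r \<Longrightarrow> (\<integral>\<^sup>+y\<in>ball z r. ennreal \<bar>h y\<bar> \<partial>lebesgue) \<le> ennreal (D * r powr (real CARD('n) - \<alpha>))"
  shows "\<bar>(LINT y|lebesgue. riesz_kernel \<alpha> h x y) - (LINT y|lebesgue. riesz_kernel \<alpha> h z y)\<bar>
    \<le> (real CARD('n) - \<alpha>) * 2 powr (2 * (real CARD('n) - \<alpha>) + 1) * D"
proof -
  let ?\<sigma> = "real CARD('n) - \<alpha>"
  have d: "0 < d" using x by (metis ball_eq_empty emptyE not_le)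
  note x_int = integrable_distant_kernel[OF hm \<alpha> h z x]
  define B where "B = ?\<sigma> * 2 powr (?\<sigma> + 1) * d"
  have B: "0 \<le> B" using \<alpha> d by (simp add: B_def)
  have pt: "\<bar>riesz_kernel \<alpha> h x y - riesz_kernel \<alpha> h z y\<bar> \<le> B * (\<bar>h y\<bar> * norm (z - y) powr - (?\<sigma> + 1))"
    if y: "y \<notin> ball z (2 * d)" for y
  proof -
    have m: "0 < norm (z - y)" using y d by auto
    have "\<bar>norm (x - y) powr - ?\<sigma> - norm (z - y) powr - ?\<sigma>\<bar>
        \<le> ?\<sigma> * (norm (z - y) / 2) powr - (?\<sigma> + 1) * \<bar>norm (x - y) - norm (z - y)\<bar>"
      using norm_diff_ge_half_norm[OF x y] m \<alpha> by (intro abs_diff_powr_minus_le) auto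
    also have "\<dots> \<le> ?\<sigma> * (norm (z - y) / 2) powr - (?\<sigma> + 1) * d"
    proof (rule mult_left_mono)
      have "\<bar>norm (x - y) - norm (z - y)\<bar> \<le> norm (x - z)"
        using norm_triangle_ineq3[of "x - y" "z - y"] by simp
      then show "\<bar>norm (x - y) - norm (z - y)\<bar> \<le> d" using x by (simp add: dist_norm norm_minus_commute)
    qed (use \<alpha> in simp)
    also have "\<dots> = B * norm (z - y) powr - (?\<sigma> + 1)"
      by (simp only: half_powr_minus[OF norm_ge_zero] B_def mult_ac)
    finally have "\<bar>h y\<bar> * \<bar>norm (x - y) powr - ?\<sigma> - norm (z - y) powr - ?\<sigma>\<bar>
        \<le> \<bar>h y\<bar> * (B * norm (z - y) powr - (?\<sigma> + 1))" by (rule mult_left_mono) simp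
    then show ?thesis
      by (simp add: riesz_kernel_eq mult_ac flip: right_diff_distrib abs_mult)
  qed
  have "(\<integral>\<^sup>+y. ennreal \<bar>riesz_kernel \<alpha> h x y - riesz_kernel \<alpha> h z y\<bar> \<partial>lebesgue)
      \<le> (\<integral>\<^sup>+y. ennreal B * (ennreal (\<bar>h y\<bar> * norm (z - y) powr - (?\<sigma> + 1)) * indicator (- ball z (2 * d)) y) \<partial>lebesgue)"
  proof (rule nn_integral_mono)
    fix y
    show "ennreal \<bar>riesz_kernel \<alpha> h x y - riesz_kernel \<alpha> h z y\<bar>
      \<le> ennreal B * (ennreal (\<bar>h y\<bar> * norm (z - y) powr - (?\<sigma> + 1)) * indicator (- ball z (2 * d)) y)"
    proof (cases "y \<in> ball z (2 * d)")
      case True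
      then show ?thesis by (simp add: h riesz_kernel_eq)
    next
      case False
      then show ?thesis using ennreal_leI[OF pt[OF False]] B by (simp add: ennreal_mult')
    qed
  qed
  also have "\<dots> = ennreal B * abs_potential (?\<sigma> + 1) h (- ball z (2 * d)) z"
  proof -
    note [measurable] = borel_measurable_abs_kernel[OF hm]
    have [measurable]: "- ball z (2 * d) \<in> sets lebesgue" by simp
    show ?thesis unfolding abs_potential_def by (rule nn_integral_cmult) measurable
  qed
  also have "\<dots> \<le> ennreal B * ennreal (2 powr ?\<sigma> / (1 - 2 powr (?\<sigma> - (?\<sigma> + 1))) * D * (2 * d) powr (?\<sigma> - (?\<sigma> + 1)))"
    using \<alpha> d D J by (intro mult_left_mono abs_potential_far[OF hm]) auto
  also have "\<dots> = ennreal (B * (2 powr ?\<sigma> / (1 - 2 powr (?\<sigma> - (?\<sigma> + 1))) * D * (2 * d) powr (?\<sigma> - (?\<sigma> + 1))))"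
    by (rule ennreal_mult'[OF B, symmetric])
  also have "B * (2 powr ?\<sigma> / (1 - 2 powr (?\<sigma> - (?\<sigma> + 1))) * D * (2 * d) powr (?\<sigma> - (?\<sigma> + 1)))
      = ?\<sigma> * (2 powr (?\<sigma> + 1) * 2 powr ?\<sigma>) * D"
    using d by (simp add: B_def powr_minus powr_one field_simps)
  also have "2 powr (?\<sigma> + 1) * 2 powr ?\<sigma> = 2 powr (2 * ?\<sigma> + 1)"
    by (simp flip: powr_add add: algebra_simps)
  finally have "\<bar>LINT y|lebesgue. riesz_kernel \<alpha> h x y - riesz_kernel \<alpha> h z y\<bar>
     \<le> ?\<sigma> * 2 powr (2 * ?\<sigma> + 1) * D"
    using x_int z \<alpha> D by (intro abs_LINT_le_of_nn_integral) auto
  then show ?thesis using x_int z by simp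
qed

section \<open>Exponential decay of the oscillation on a cube\<close>

text \<open>The Morrey condition with balls in place of cubes; \<open>s\<close> stands for \<open>n - \<alpha>p\<close>.\<close>

definition ball_growth :: "real \<Rightarrow> real \<Rightarrow> real \<Rightarrow> (real ^ 'n \<Rightarrow> real) \<Rightarrow> bool" where
  "ball_growth p s M f \<longleftrightarrow> f \<in> borel_measurable lebesgue \<and>
     (\<forall>x r. 0 < r \<longrightarrow> (\<integral>\<^sup>+y\<in>ball x r. ennreal (\<bar>f y\<bar> powr p) \<partial>lebesgue) \<le> ennreal (M powr p * r powr s))"

lemma ball_growth_restrict:
  fixes f :: "real ^ 'n::finite \<Rightarrow> real"
  assumes f: "ball_growth p s M f" and S: "S \<in> sets lebesgue"
  shows "ball_growth p s M (\<lambda>y. f y * indicator S y)"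
proof -
  have [measurable]: "f \<in> borel_measurable lebesgue" "S \<in> sets lebesgue" using assms by (auto simp: ball_growth_def)
  have "(\<integral>\<^sup>+y\<in>ball x r. ennreal (\<bar>f y * indicator S y\<bar> powr p) \<partial>lebesgue)
      \<le> ennreal (M powr p * r powr s)" if "0 < r" for x r
  proof -
    have "(\<integral>\<^sup>+y\<in>ball x r. ennreal (\<bar>f y * indicator S y\<bar> powr p) \<partial>lebesgue)
      \<le> (\<integral>\<^sup>+y\<in>ball x r. ennreal (\<bar>f y\<bar> powr p) \<partial>lebesgue)"
      by (intro nn_integral_mono) (auto simp: indicator_def)
    also have "\<dots> \<le> ennreal (M powr p * r powr s)" using f that by (simp add: ball_growth_def)
    finally show ?thesis .
  qed
  then show ?thesis unfolding ball_growth_def by simp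
qed

lemma ball_growth_L1:
  fixes f :: "real ^ 'n::finite \<Rightarrow> real"
  assumes f: "ball_growth p (real CARD('n) - \<alpha> * p) M f" and p: "1 \<le> p" and M: "0 < M" and r: "0 < r"
  shows "(\<integral>\<^sup>+y\<in>ball x r. ennreal \<bar>f y\<bar> \<partial>lebesgue)
     \<le> ennreal ((1 + unit_ball_vol (real CARD('n))) * M * r powr (real CARD('n) - \<alpha>))"
proof -
  have e: "real CARD('n) + (real CARD('n) - \<alpha> * p - real CARD('n)) / p = real CARD('n) - \<alpha>"
    using p by (simp add: field_simps)
  show ?thesis
    using nn_integral_ball_le_of_powr[of f p M r x "real CARD('n) - \<alpha> * p"] f p M r
    unfolding e by (simp add: ball_growth_def)
qed

lemma riesz_kernel_split:
  "riesz_kernel \<alpha> f x y =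
     riesz_kernel \<alpha> (\<lambda>y. f y * indicator S y) x y + riesz_kernel \<alpha> (\<lambda>y. f y * indicator (- S) y) x y"
  for x :: "real ^ 'n::finite"
  by (auto simp: riesz_kernel_eq indicator_def)

lemma integrable_riesz_kernel_restrict:
  fixes f :: "real ^ 'n::finite \<Rightarrow> real"
  assumes f: "integrable lebesgue (riesz_kernel \<alpha> f x)" and S: "S \<in> sets lebesgue"
  shows "integrable lebesgue (riesz_kernel \<alpha> (\<lambda>y. f y * indicator S y) x)"
proof -
  have "riesz_kernel \<alpha> (\<lambda>y. f y * indicator S y) x = (\<lambda>y. riesz_kernel \<alpha> f x y * indicator S y)"
    by (auto simp: riesz_kernel_eq)
  then show ?thesis using integrable_mult_indicator[OF S f] by (simp add: mult.commute)
qed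

lemma riesz_const_pos: "0 < \<alpha> \<Longrightarrow> \<alpha> < real n \<Longrightarrow> 0 < riesz_const n \<alpha>"
  unfolding riesz_const_def by (intro divide_pos_pos mult_pos_pos Gamma_real_pos) auto

text \<open>The sum of the constants for the part of \<open>f\<close> near the cube and for the distant part, divided by the
  normalization of the potential.\<close>

definition oscillation_const :: "nat \<Rightarrow> real \<Rightarrow> real \<Rightarrow> real \<Rightarrow> real" where
  "oscillation_const n \<alpha> \<beta> p =
     (shell_const n (real n - \<alpha>) ((\<beta> - (real n - \<alpha> * p)) / p)
      + (real n - \<alpha>) * 2 powr (2 * (real n - \<alpha>) + 1) * (1 + unit_ball_vol (real n)))
     / riesz_const n \<alpha>"

text \<open>The absolute value keeps the last factor at least \<open>1\<close> for either sign of \<open>n - \<alpha>p\<close>, so that the constant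
  dominates \<open>\<omega>\<^sub>\<beta>\<close>.\<close>

definition level_const :: "nat \<Rightarrow> real \<Rightarrow> real \<Rightarrow> real \<Rightarrow> real" where
  "level_const n \<alpha> \<beta> p =
     unit_ball_vol \<beta> * 5 powr \<beta> * 3 powr (\<beta> - (real n - \<alpha> * p)) * 2 powr \<bar>real n - \<alpha> * p\<bar>"

text \<open>The situation around one cube: \<open>z\<close> is a point of the cube at which the potential converges, and
  \<open>B(z, d)\<close> contains the cube. The function is cut at radius \<open>2d\<close> into a near part, which is integrable,
  and a distant part, whose potential is nearly constant on the cube.\<close>

locale morrey_near_point =
  fixes \<alpha> \<beta> p M d :: real and f :: "real ^ 'n::finite \<Rightarrow> real" and z :: "real ^ 'n"
  assumes \<alpha>_pos: "0 < \<alpha>" and \<alpha>_less: "\<alpha> < real CARD('n)" and p_ge: "1 \<le> p"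
    and \<beta>_pos: "0 < \<beta>" and \<beta>_greater: "real CARD('n) - \<alpha> * p < \<beta>"
    and M_pos: "0 < M" and d_pos: "0 < d"
    and growth: "ball_growth p (real CARD('n) - \<alpha> * p) M f"
    and conv: "integrable lebesgue (riesz_kernel \<alpha> f z)"
begin

definition "near = (\<lambda>y. f y * indicator (ball z (2 * d)) y)"
definition "distant = (\<lambda>y. f y * indicator (- ball z (2 * d)) y)"

abbreviation "potential g x \<equiv> (LINT y|lebesgue. riesz_kernel \<alpha> g x y)"
abbreviation "heavy T \<equiv> heavy_points \<beta> (T powr p) (power_measure p near)"

lemma near_growth: "ball_growth p (real CARD('n) - \<alpha> * p) M near"
  unfolding near_def by (rule ball_growth_restrict[OF growth]) simp

lemma distant_growth: "ball_growth p (real CARD('n) - \<alpha> * p) M distant"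
  unfolding distant_def by (rule ball_growth_restrict[OF growth]) simp

lemma near_measurable: "near \<in> borel_measurable lebesgue"
  using near_growth by (simp add: ball_growth_def)

lemma distant_measurable: "distant \<in> borel_measurable lebesgue"
  using distant_growth by (simp add: ball_growth_def)

lemma distant_eq_0: "y \<in> ball z (2 * d) \<Longrightarrow> distant y = 0"
  by (simp add: distant_def)

lemma distant_conv: "integrable lebesgue (riesz_kernel \<alpha> distant z)"
  unfolding distant_def by (rule integrable_riesz_kernel_restrict[OF conv]) simp

lemma near_integrable: "integrable lebesgue near"
proof (rule integrableI_bounded[OF near_measurable])
  have "(\<integral>\<^sup>+y. ennreal (norm (near y)) \<partial>lebesgue) = (\<integral>\<^sup>+y\<in>ball z (2 * d). ennreal \<bar>near y\<bar> \<partial>lebesgue)"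
    by (intro nn_integral_cong) (auto simp: near_def indicator_def)
  also have "\<dots> < \<infinity>"
    using ball_growth_L1[OF near_growth p_ge M_pos, of "2 * d" z] d_pos
    by (auto intro: order_le_less_trans)
  finally show "(\<integral>\<^sup>+y. ennreal (norm (near y)) \<partial>lebesgue) < \<infinity>" .
qed

lemma near_power_integral:
  "(\<integral>\<^sup>+y. ennreal (\<bar>near y\<bar> powr p) \<partial>lebesgue) \<le> ennreal (M powr p * (2 * d) powr (real CARD('n) - \<alpha> * p))"
proof -
  have "(\<integral>\<^sup>+y. ennreal (\<bar>near y\<bar> powr p) \<partial>lebesgue) = (\<integral>\<^sup>+y\<in>ball z (2 * d). ennreal (\<bar>near y\<bar> powr p) \<partial>lebesgue)"
    by (intro nn_integral_cong) (auto simp: near_def indicator_def)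
  also have "\<dots> \<le> ennreal (M powr p * (2 * d) powr (real CARD('n) - \<alpha> * p))"
    using near_growth d_pos by (simp add: ball_growth_def)
  finally show ?thesis .
qed

lemma content_heavy:
  assumes "0 < T"
  shows "hausdorff_content \<beta> (heavy T)
    \<le> ennreal (unit_ball_vol \<beta> * 5 powr \<beta> / T powr p * (M powr p * (2 * d) powr (real CARD('n) - \<alpha> * p)))"
  using assms \<beta>_pos near_power_integral
  by (intro hausdorff_content_heavy_points_power_measure near_measurable) auto

lemma open_heavy: "open (heavy T)"
  by (rule open_heavy_points[OF sets_power_measure])

lemma potential_split:
  assumes x: "x \<in> ball z d" and f: "integrable lebesgue (riesz_kernel \<alpha> f x)"
  shows "potential f x = potential near x + potential distant x"
proof -
  have i: "integrable lebesgue (riesz_kernel \<alpha> near x)"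
    unfolding near_def by (rule integrable_riesz_kernel_restrict[OF f]) simp
  have j: "integrable lebesgue (riesz_kernel \<alpha> distant x)"
    unfolding distant_def by (rule integrable_riesz_kernel_restrict[OF f]) simp
  have "riesz_kernel \<alpha> f x = (\<lambda>y. riesz_kernel \<alpha> near x y + riesz_kernel \<alpha> distant x y)"
    unfolding near_def distant_def by (intro ext riesz_kernel_split)
  then show ?thesis using i j by simp
qed

lemma integrable_at_light_point:
  assumes x: "x \<in> ball z d" "x \<notin> heavy T" and T: "0 < T"
  shows "integrable lebesgue (riesz_kernel \<alpha> f x)"
proof -
  have i: "integrable lebesgue (riesz_kernel \<alpha> near x)"
    by (rule integrable_riesz_kernel_light_point[OF near_integrable p_ge \<alpha>_less \<beta>_greater T x(2)])
  have j: "integrable lebesgue (riesz_kernel \<alpha> distant x)"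
    by (rule integrable_distant_kernel[OF distant_measurable \<alpha>_less distant_eq_0 distant_conv x(1)])
  have "riesz_kernel \<alpha> f x = (\<lambda>y. riesz_kernel \<alpha> near x y + riesz_kernel \<alpha> distant x y)"
    unfolding near_def distant_def by (intro ext riesz_kernel_split)
  then show ?thesis using i j by simp
qed

lemma continuous_on_light:
  assumes T: "0 < T"
  shows "continuous_on (ball z d - heavy T) (potential f)"
proof -
  have "continuous_on (ball z d - heavy T) (potential near)"
    by (rule continuous_on_subset[OF continuous_on_light_points[OF near_integrable p_ge \<alpha>_less \<beta>_greater T]]) auto
  moreover have "continuous_on (ball z d - heavy T) (potential distant)"
    by (rule continuous_on_subset[OF continuous_on_distant_potential[OF distant_measurable \<alpha>_less distant_eq_0 distant_conv]]) auto
  ultimately have "continuous_on (ball z d - heavy T) (\<lambda>x. potential near x + potential distant x)"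
    by (rule continuous_on_add)
  then show ?thesis
    by (rule continuous_on_eq) (use potential_split integrable_at_light_point T in auto)
qed

lemma ex_small_heavy:
  assumes "0 < \<epsilon>"
  shows "\<exists>T>0. hausdorff_content \<beta> (heavy T) < ennreal \<epsilon>"
proof -
  define X where "X = unit_ball_vol \<beta> * 5 powr \<beta>"
  define Y where "Y = M powr p * (2 * d) powr (real CARD('n) - \<alpha> * p)"
  have X: "0 < X" using \<beta>_pos by (simp add: X_def)
  have Y: "0 < Y" using M_pos d_pos by (simp add: Y_def)
  \<comment> \<open>Chosen so that the bound of \<open>content_heavy\<close> equals \<open>\<epsilon> / 2\<close>.\<close>
  define T where "T = (2 * (X * Y) / \<epsilon>) powr (1 / p)"
  have T: "0 < T" using X Y assms by (simp add: T_def)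
  have "T powr p = 2 * (X * Y) / \<epsilon>" using X Y assms p_ge by (simp add: T_def powr_powr)
  then have "X / T powr p * Y = \<epsilon> / 2" using X Y assms by simp
  then have "hausdorff_content \<beta> (heavy T) \<le> ennreal (\<epsilon> / 2)"
    using content_heavy[OF T] by (simp only: X_def[symmetric] Y_def[symmetric])
  also have "\<dots> < ennreal \<epsilon>" using assms by (simp add: ennreal_less_iff)
  finally show ?thesis using T by blast
qed

text \<open>The heavy points of a large threshold serve as the exceptional open set: their content is small,
  and outside them the potential converges and is continuous. As the rest of \<open>Q\<close> lies in
  the domain, the divergence points in \<open>Q\<close> have content \<open>0\<close>.\<close>

lemma quasicontinuous_potential:
  assumes Q: "open Q" "Q \<subseteq> ball z d"
  shows "quasicontinuous \<beta> Q (riesz_potential \<alpha> f |` Q)"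
proof -
  have dom: "Q - heavy T \<subseteq> dom (riesz_potential \<alpha> f |` Q)" if "0 < T" for T
    using integrable_at_light_point[OF _ _ that] Q by (auto simp: riesz_potential_def restrict_map_def)
  have small: "\<exists>U. open U \<and> U \<subseteq> Q \<and> hausdorff_content \<beta> U < ennreal \<epsilon> \<and>
        Q - U \<subseteq> dom (riesz_potential \<alpha> f |` Q) \<and> continuous_on (Q - U) (\<lambda>x. the ((riesz_potential \<alpha> f |` Q) x))"
    if \<epsilon>: "0 < \<epsilon>" for \<epsilon>
  proof -
    obtain T where T: "0 < T" "hausdorff_content \<beta> (heavy T) < ennreal \<epsilon>" using ex_small_heavy[OF \<epsilon>] by blast
    have "continuous_on (Q - heavy T) (\<lambda>x. 1 / riesz_const CARD('n) \<alpha> * potential f x)"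
      using Q by (intro continuous_on_mult continuous_on_const continuous_on_subset[OF continuous_on_light[OF T(1)]]) auto
    moreover have "1 / riesz_const CARD('n) \<alpha> * potential f x = the ((riesz_potential \<alpha> f |` Q) x)"
      if "x \<in> Q - heavy T" for x
      using integrable_at_light_point[OF _ _ T(1)] Q that by (auto simp: riesz_potential_def)
    ultimately have "continuous_on (Q - heavy T) (\<lambda>x. the ((riesz_potential \<alpha> f |` Q) x))"
      by (rule continuous_on_eq)
    moreover have "Q - (heavy T \<inter> Q) = Q - heavy T" by blast
    moreover have "hausdorff_content \<beta> (heavy T \<inter> Q) < ennreal \<epsilon>"
      using T(2) hausdorff_content_mono[of "heavy T \<inter> Q" "heavy T" \<beta>] by (auto intro: order_le_less_trans)
    ultimately show ?thesis
      using dom[OF T(1)] open_heavy[of T] Q(1) by (intro exI[of _ "heavy T \<inter> Q"]) auto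
  qed
  have "hausdorff_content \<beta> (Q - dom (riesz_potential \<alpha> f |` Q)) \<le> 0"
  proof (rule ennreal_le_epsilon)
    fix \<epsilon> :: real assume \<epsilon>: "0 < \<epsilon>"
    obtain U where "hausdorff_content \<beta> U < ennreal \<epsilon>" "Q - U \<subseteq> dom (riesz_potential \<alpha> f |` Q)"
      using small[OF \<epsilon>] by blast
    moreover from this have "hausdorff_content \<beta> (Q - dom (riesz_potential \<alpha> f |` Q)) \<le> hausdorff_content \<beta> U"
      by (intro hausdorff_content_mono) blast
    ultimately show "hausdorff_content \<beta> (Q - dom (riesz_potential \<alpha> f |` Q)) \<le> 0 + ennreal \<epsilon>" by simp
  qed
  then show ?thesis unfolding quasicontinuous_def using small by simp
qed

lemma oscillation_const_pos: "0 < oscillation_const CARD('n) \<alpha> \<beta> p"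
  unfolding oscillation_const_def
  using \<alpha>_pos \<alpha>_less \<beta>_greater p_ge
  by (intro divide_pos_pos add_pos_nonneg shell_const_pos riesz_const_pos) auto

text \<open>The reference value is the potential of the distant part at \<open>z\<close>. The ball of radius \<open>3d\<close> around \<open>x\<close>
  contains the support of the near part, so all of it is seen by the shells around \<open>x\<close>.\<close>

lemma oscillation_at_light_point:
  assumes x: "x \<in> ball z d"
    and light: "x \<notin> heavy (M * (3 * d / 2 ^ N) powr - ((\<beta> - (real CARD('n) - \<alpha> * p)) / p))"
    and v: "riesz_potential \<alpha> f x = Some v"
  shows "\<bar>v - 1 / riesz_const CARD('n) \<alpha> * potential distant z\<bar> \<le> oscillation_const CARD('n) \<alpha> \<beta> p * M * (1 + real N)"
proof -
  let ?\<sigma> = "real CARD('n) - \<alpha>"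
  let ?K = "shell_const CARD('n) ?\<sigma> ((\<beta> - (real CARD('n) - \<alpha> * p)) / p)"
  let ?B = "?\<sigma> * 2 powr (2 * ?\<sigma> + 1) * (1 + unit_ball_vol (real CARD('n)))"
  let ?\<gamma> = "riesz_const CARD('n) \<alpha>"
  have \<gamma>: "0 < ?\<gamma>" using riesz_const_pos \<alpha>_pos \<alpha>_less by blast
  have K: "0 < ?K" using \<beta>_greater p_ge by (intro shell_const_pos) simp
  have B: "0 \<le> ?B" using \<alpha>_less by (intro mult_nonneg_nonneg) auto
  have f: "integrable lebesgue (riesz_kernel \<alpha> f x)" and v_eq: "v = 1 / ?\<gamma> * potential f x"
    using v by (auto simp: riesz_potential_def split: if_splits)
  have sub: "ball z (2 * d) \<subseteq> ball x (3 * d)"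
  proof
    fix y assume "y \<in> ball z (2 * d)"
    then show "y \<in> ball x (3 * d)" using x dist_triangle[of x y z] by (simp add: dist_commute)
  qed
  have i: "integrable lebesgue (riesz_kernel \<alpha> near x)"
    unfolding near_def by (rule integrable_riesz_kernel_restrict[OF f]) simp
  have "abs_potential ?\<sigma> near UNIV x \<le> abs_potential ?\<sigma> near (ball x (3 * d)) x"
    unfolding abs_potential_def using sub by (intro nn_integral_mono) (auto simp: near_def indicator_def)
  also have "\<dots> \<le> ennreal (?K * M * (1 + real N))"
    using d_pos
    by (intro abs_potential_light_point[OF near_measurable p_ge \<alpha>_less \<beta>_greater M_pos] light
          ball_growth_L1[OF near_growth p_ge M_pos]) auto
  finally have "(\<integral>\<^sup>+y. ennreal \<bar>riesz_kernel \<alpha> near x y\<bar> \<partial>lebesgue) \<le> ennreal (?K * M * (1 + real N))"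
    using nn_integral_riesz_kernel[of \<alpha> near x] by simp
  then have near: "\<bar>potential near x\<bar> \<le> ?K * M * (1 + real N)"
    using i K M_pos by (intro abs_LINT_le_of_nn_integral) auto
  have "\<bar>potential distant x - potential distant z\<bar>
     \<le> ?\<sigma> * 2 powr (2 * ?\<sigma> + 1) * ((1 + unit_ball_vol (real CARD('n))) * M)"
    using M_pos
    by (intro distant_potential_oscillation[OF distant_measurable \<alpha>_less distant_eq_0 distant_conv x]
          ball_growth_L1[OF distant_growth p_ge M_pos]) auto
  then have "\<bar>potential distant x - potential distant z\<bar> \<le> ?B * M * 1"
    by (simp add: mult_ac)
  also have "\<dots> \<le> ?B * M * (1 + real N)"
    using B M_pos by (intro mult_left_mono mult_nonneg_nonneg[OF B]) auto
  finally have "\<bar>potential f x - potential distant z\<bar> \<le> ?K * M * (1 + real N) + ?B * M * (1 + real N)"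
    using near potential_split[OF x f] by linarith
  also have "\<dots> = (?K + ?B) * M * (1 + real N)" by (simp only: distrib_right)
  finally have "\<bar>potential f x - potential distant z\<bar> / ?\<gamma> \<le> (?K + ?B) * M * (1 + real N) / ?\<gamma>"
    using \<gamma> by (intro divide_right_mono) auto
  moreover have "v - 1 / ?\<gamma> * potential distant z = (potential f x - potential distant z) / ?\<gamma>"
    by (simp add: v_eq diff_divide_distrib)
  ultimately show ?thesis
    using \<gamma> unfolding oscillation_const_def by (simp add: abs_divide)
qed

text \<open>For the threshold belonging to depth \<open>N\<close> the powers of \<open>M\<close> cancel and those of \<open>d\<close> combine to \<open>d\<^sup>\<beta>\<close>,
  leaving the factor \<open>2\<^bsup>-(\<beta>-s)N\<^esup>\<close> with \<open>s = n - \<alpha>p\<close>.\<close>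

lemma content_heavy_dyadic:
  "hausdorff_content \<beta> (heavy (M * (3 * d / 2 ^ N) powr - ((\<beta> - (real CARD('n) - \<alpha> * p)) / p)))
    \<le> ennreal (level_const CARD('n) \<alpha> \<beta> p * d powr \<beta> * 2 powr - ((\<beta> - (real CARD('n) - \<alpha> * p)) * real N))"
proof -
  define s where "s = real CARD('n) - \<alpha> * p"
  define \<delta> where "\<delta> = 3 * d / 2 ^ N"
  have \<delta>: "0 < \<delta>" using d_pos by (simp add: \<delta>_def)
  let ?T = "M * \<delta> powr - ((\<beta> - s) / p)"
  have T: "0 < ?T" using M_pos \<delta> by simp
  have "?T powr p = M powr p * \<delta> powr - (\<beta> - s)"
    using M_pos \<delta> p_ge by (simp add: powr_mult powr_powr)
  then have "unit_ball_vol \<beta> * 5 powr \<beta> / ?T powr p * (M powr p * (2 * d) powr s)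
      = unit_ball_vol \<beta> * 5 powr \<beta> * \<delta> powr (\<beta> - s) * (2 * d) powr s"
    using M_pos by (simp only: powr_minus_divide) simp
  also have "\<delta> powr (\<beta> - s) = 3 powr (\<beta> - s) * d powr (\<beta> - s) * 2 powr - ((\<beta> - s) * real N)"
  proof -
    have "(2::real) ^ N = 2 powr real N" by (simp add: powr_realpow)
    then have "((2::real) ^ N) powr (\<beta> - s) = 2 powr ((\<beta> - s) * real N)"
      by (simp add: powr_powr mult.commute)
    then show ?thesis
      using d_pos by (simp add: \<delta>_def powr_divide powr_mult powr_minus_divide)
  qed
  also have "unit_ball_vol \<beta> * 5 powr \<beta> * (3 powr (\<beta> - s) * d powr (\<beta> - s) * 2 powr - ((\<beta> - s) * real N)) * (2 * d) powr s
     = unit_ball_vol \<beta> * 5 powr \<beta> * 3 powr (\<beta> - s) * 2 powr s * (d powr (\<beta> - s) * d powr s) * 2 powr - ((\<beta> - s) * real N)"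
    using d_pos by (simp add: powr_mult mult_ac)
  also have "d powr (\<beta> - s) * d powr s = d powr \<beta>"
    by (simp flip: powr_add)
  also have "unit_ball_vol \<beta> * 5 powr \<beta> * 3 powr (\<beta> - s) * 2 powr s * d powr \<beta> * 2 powr - ((\<beta> - s) * real N)
     \<le> level_const CARD('n) \<alpha> \<beta> p * d powr \<beta> * 2 powr - ((\<beta> - s) * real N)"
    using \<beta>_pos unfolding level_const_def s_def
    by (intro mult_right_mono mult_left_mono mult_nonneg_nonneg powr_mono) auto
  finally have "unit_ball_vol \<beta> * 5 powr \<beta> / ?T powr p * (M powr p * (2 * d) powr s)
     \<le> level_const CARD('n) \<alpha> \<beta> p * d powr \<beta> * 2 powr - ((\<beta> - s) * real N)" .
  moreover have "hausdorff_content \<beta> (heavy ?T)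
      \<le> ennreal (unit_ball_vol \<beta> * 5 powr \<beta> / ?T powr p * (M powr p * (2 * d) powr s))"
    using content_heavy[OF T] by (simp add: s_def)
  ultimately have "hausdorff_content \<beta> (heavy ?T) \<le> ennreal (level_const CARD('n) \<alpha> \<beta> p * d powr \<beta> * 2 powr - ((\<beta> - s) * real N))"
    by (meson ennreal_leI order_trans)
  then show ?thesis unfolding \<delta>_def s_def .
qed

lemma level_const_ge: "unit_ball_vol \<beta> \<le> level_const CARD('n) \<alpha> \<beta> p"
proof -
  have "1 * (1 * 1) \<le> 5 powr \<beta> * (3 powr (\<beta> - (real CARD('n) - \<alpha> * p)) * 2 powr \<bar>real CARD('n) - \<alpha> * p\<bar>)"
    using \<beta>_pos \<beta>_greater by (intro mult_mono ge_one_powr_ge_zero) auto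
  then have "unit_ball_vol \<beta> * 1 \<le> unit_ball_vol \<beta> *
     (5 powr \<beta> * (3 powr (\<beta> - (real CARD('n) - \<alpha> * p)) * 2 powr \<bar>real CARD('n) - \<alpha> * p\<bar>))"
    using \<beta>_pos by (intro mult_left_mono) auto
  then show ?thesis by (simp add: level_const_def mult_ac)
qed

text \<open>For a level \<open>t\<close> of at least one unit \<open>oscillation_const * M\<close>, a depth \<open>N\<close> with \<open>1 + N\<close> close to the number
  of units puts the superlevel set inside the heavy points of that depth. Below one unit the
  content of the whole cube is a sufficient bound.\<close>

lemma exponential_decay:
  assumes Q: "Q \<subseteq> ball z d" and t: "0 \<le> t"
  shows "hausdorff_content \<beta> {x \<in> Q. \<exists>v. riesz_potential \<alpha> f x = Some v \<and>
             t < \<bar>v - 1 / riesz_const CARD('n) \<alpha> * potential distant z\<bar>}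
    \<le> ennreal (level_const CARD('n) \<alpha> \<beta> p * d powr \<beta> *
        2 powr - ((\<beta> - (real CARD('n) - \<alpha> * p)) * (t / (oscillation_const CARD('n) \<alpha> \<beta> p * M) - 2)))"
    (is "hausdorff_content \<beta> ?E \<le> ennreal (?A * 2 powr - (?b * (?t - 2)))")
proof -
  have b: "0 < ?b" using \<beta>_greater by simp
  have "0 \<le> level_const CARD('n) \<alpha> \<beta> p" using level_const_ge unit_ball_vol_nonneg[of \<beta>] \<beta>_pos by linarith
  then have A: "0 \<le> ?A" by simp
  have OM: "0 < oscillation_const CARD('n) \<alpha> \<beta> p * M" using oscillation_const_pos M_pos by simp
  have t': "0 \<le> ?t" using t OM by simp
  show ?thesis
  proof (cases "?t < 1")
    case True
    have "hausdorff_content \<beta> ?E \<le> hausdorff_content \<beta> (ball z d)"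
      using Q by (intro hausdorff_content_mono) auto
    also have "\<dots> \<le> ennreal (unit_ball_vol \<beta> * d powr \<beta>)"
      using d_pos by (intro hausdorff_content_ball_le) simp
    also have "\<dots> \<le> ennreal (?A * 2 powr - (?b * (?t - 2)))"
    proof (rule ennreal_leI)
      have "unit_ball_vol \<beta> * d powr \<beta> * 1 \<le> ?A * 1"
        using level_const_ge by (intro mult_right_mono) auto
      also have "\<dots> \<le> ?A * 2 powr - (?b * (?t - 2))"
        using A b True by (intro mult_left_mono ge_one_powr_ge_zero) (auto simp: mult_le_0_iff)
      finally show "unit_ball_vol \<beta> * d powr \<beta> \<le> ?A * 2 powr - (?b * (?t - 2))" by simp
    qed
    finally show ?thesis .
  next
    case False
    \<comment> \<open>The largest \<open>N\<close> with \<open>1 + N \<le> ?t\<close>; losing at most \<open>2\<close> here explains the shift by \<open>2\<close> in the exponent.\<close>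
    define N where "N = nat (\<lfloor>?t\<rfloor> - 1)"
    have N: "1 + real N \<le> ?t" "?t - 2 \<le> real N"
      using False by (auto simp: N_def) linarith+
    have "?E \<subseteq> heavy (M * (3 * d / 2 ^ N) powr - (?b / p))"
    proof
      fix x assume "x \<in> ?E"
      then obtain v where x: "x \<in> ball z d" and v: "riesz_potential \<alpha> f x = Some v"
        and "t < \<bar>v - 1 / riesz_const CARD('n) \<alpha> * potential distant z\<bar>" using Q by blast
      moreover have "oscillation_const CARD('n) \<alpha> \<beta> p * M * (1 + real N) \<le> t"
        using N(1) unfolding pos_le_divide_eq[OF OM] by (simp add: mult.commute)
      ultimately show "x \<in> heavy (M * (3 * d / 2 ^ N) powr - (?b / p))"
        using oscillation_at_light_point[OF x _ v, of N] by fastforce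
    qed
    then have "hausdorff_content \<beta> ?E \<le> ennreal (?A * 2 powr - (?b * real N))"
      using content_heavy_dyadic[of N] hausdorff_content_mono order_trans by blast
    also have "\<dots> \<le> ennreal (?A * 2 powr - (?b * (?t - 2)))"
      using A b N(2) by (intro ennreal_leI mult_left_mono powr_mono) auto
    finally show ?thesis .
  qed
qed

end

section \<open>Cubes and the Morrey norm\<close>

lemma cube_subset_ball:
  fixes a z :: "real ^ 'n::finite"
  assumes z: "z \<in> cube a l"
  shows "cube a l \<subseteq> ball z (real CARD('n) * l)"
proof
  fix x assume x: "x \<in> cube a l"
  have "\<bar>(z - x) $ i\<bar> < l" for i
  proof -
    have "a $ i < z $ i" "z $ i < a $ i + l" "a $ i < x $ i" "x $ i < a $ i + l"
      using x z by (auto simp: cube_def mem_box_cart)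
    then show ?thesis by simp
  qed
  then have "(\<Sum>i\<in>UNIV. \<bar>(z - x) $ i\<bar>) < (\<Sum>i\<in>(UNIV :: 'n set). l)"
    by (intro sum_strict_mono) simp_all
  also have "\<dots> = real CARD('n) * l" by simp
  finally have "norm (z - x) < real CARD('n) * l"
    using norm_le_l1_cart[of "z - x"] by (rule order_le_less_trans[rotated])
  then show "x \<in> ball z (real CARD('n) * l)" by (simp add: dist_norm)
qed

lemma ball_subset_cube:
  fixes x :: "real ^ 'n::finite"
  shows "ball x r \<subseteq> cube (x - (\<chi> i. r)) (2 * r)"
proof
  fix y assume "y \<in> ball x r"
  then have abs: "\<bar>x $ i - y $ i\<bar> < r" for i
    using component_le_norm_cart[of "x - y" i] by (simp add: dist_norm)
  have "x $ i - r < y $ i \<and> y $ i < x $ i - r + 2 * r" for i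
    using abs[of i] by (simp add: abs_less_iff)
  then show "y \<in> cube (x - (\<chi> i. r)) (2 * r)"
    by (simp add: cube_def mem_box_cart)
qed

lemma open_cube: "open (cube a l)"
  by (simp add: cube_def open_box)

lemma cube_nonempty:
  assumes "0 < l"
  shows "cube a l \<noteq> {}"
proof -
  have "a + (\<chi> i. l / 2) \<in> cube a l" using assms by (simp add: cube_def mem_box_cart)
  then show ?thesis by blast
qed

lemma cube_meets_dom:
  fixes a :: "real ^ 'n::finite"
  assumes "u \<in> L1_loc" "0 < l"
  shows "cube a l \<inter> dom u \<noteq> {}"
proof
  assume empty: "cube a l \<inter> dom u = {}"
  have "AE x in lebesgue. x \<in> dom u" using assms(1) by (simp add: L1_loc_def)
  then have "AE x in lebesgue. x \<notin> cube a l" by eventually_elim (use empty in auto)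
  then have "negligible (cube a l)"
    by (simp add: negligible_iff_null_sets AE_iff_null_sets cube_def)
  then show False using open_not_negligible[OF open_cube cube_nonempty[OF assms(2)]] by blast
qed

text \<open>Solves the inequality defining the norm for the integral. A finite norm excludes an infinite
  integral, since \<open>powr_ennreal\<close> sends \<open>\<infinity>\<close> to \<open>\<infinity>\<close>.\<close>

lemma cube_integral_le_of_morrey_norm:
  fixes f :: "real ^ 'n::finite \<Rightarrow> real"
  assumes N: "morrey_norm \<alpha> p f \<le> ennreal M" and M: "0 \<le> M" and p: "1 \<le> p" and l: "0 < l"
  shows "(\<integral>\<^sup>+y\<in>cube a l. ennreal (\<bar>f y\<bar> powr p) \<partial>lebesgue) \<le> ennreal (M powr p * l powr (real CARD('n) - \<alpha> * p))"
proof -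
  let ?I = "\<integral>\<^sup>+y\<in>cube a l. ennreal (\<bar>f y\<bar> powr p) \<partial>lebesgue" and ?L = "l ^ CARD('n)"
  have L: "0 < ?L" "?L = l powr real CARD('n)" using l by (auto simp: powr_realpow)
  have "ennreal (l powr \<alpha>) * powr_ennreal (?I / ennreal ?L) (1 / p) \<le> morrey_norm \<alpha> p f"
    unfolding morrey_norm_def using l by (intro SUP_upper2[of "(a, l)"]) auto
  with N have le: "ennreal (l powr \<alpha>) * powr_ennreal (?I / ennreal ?L) (1 / p) \<le> ennreal M" by simp
  have fin: "?I / ennreal ?L \<noteq> \<infinity>"
  proof
    assume "?I / ennreal ?L = \<infinity>"
    then have "ennreal (l powr \<alpha>) * \<infinity> \<le> ennreal M" using le by (simp add: powr_ennreal_def)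
    then show False using l by (simp add: ennreal_mult_top top_unique)
  qed
  then have "?I \<noteq> \<infinity>"
    using L by (auto simp: ennreal_top_divide)
  then obtain i where i: "0 \<le> i" "?I = ennreal i" by (cases ?I) auto
  have "?I / ennreal ?L = ennreal (i / ?L)" using i L by (simp add: divide_ennreal)
  then have "ennreal (l powr \<alpha>) * ennreal ((i / ?L) powr (1 / p)) \<le> ennreal M"
    using le i L by (simp add: powr_ennreal_def)
  then have "l powr \<alpha> * (i / ?L) powr (1 / p) \<le> M"
    using M by (simp flip: ennreal_mult)
  then have "(i / ?L) powr (1 / p) \<le> M * l powr - \<alpha>"
    using l by (simp add: powr_minus_divide field_simps)
  then have "((i / ?L) powr (1 / p)) powr p \<le> (M * l powr - \<alpha>) powr p"
    using p by (intro powr_mono2) auto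
  then have "i / ?L \<le> M powr p * l powr - (\<alpha> * p)"
    using p i L M by (simp add: powr_powr powr_mult)
  then have "i \<le> M powr p * l powr - (\<alpha> * p) * ?L"
    using L by (simp add: pos_divide_le_eq)
  also have "\<dots> = M powr p * l powr (real CARD('n) - \<alpha> * p)"
    unfolding L(2) by (simp add: mult.assoc flip: powr_add)
  finally show ?thesis unfolding i(2) by (rule ennreal_leI)
qed

lemma ball_growth_of_morrey_norm:
  fixes f :: "real ^ 'n::finite \<Rightarrow> real"
  assumes f: "f \<in> borel_measurable lebesgue" and N: "morrey_norm \<alpha> p f \<le> ennreal M" and M: "0 \<le> M" and p: "1 \<le> p"
  shows "ball_growth p (real CARD('n) - \<alpha> * p) (M * 2 powr ((real CARD('n) - \<alpha> * p) / p)) f"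
proof -
  let ?s = "real CARD('n) - \<alpha> * p"
  have "(\<integral>\<^sup>+y\<in>ball x r. ennreal (\<bar>f y\<bar> powr p) \<partial>lebesgue) \<le> ennreal ((M * 2 powr (?s / p)) powr p * r powr ?s)"
    if r: "0 < r" for x r
  proof -
    have "(\<integral>\<^sup>+y\<in>ball x r. ennreal (\<bar>f y\<bar> powr p) \<partial>lebesgue)
       \<le> (\<integral>\<^sup>+y\<in>cube (x - (\<chi> i. r)) (2 * r). ennreal (\<bar>f y\<bar> powr p) \<partial>lebesgue)"
      using ball_subset_cube[of x r] by (intro nn_integral_mono) (auto simp: indicator_def)
    also have "\<dots> \<le> ennreal (M powr p * (2 * r) powr ?s)"
      using r by (intro cube_integral_le_of_morrey_norm N M p) simp
    also have "M powr p * (2 * r) powr ?s = (M * 2 powr (?s / p)) powr p * r powr ?s"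
      using r p M by (simp add: powr_mult powr_powr)
    finally show ?thesis .
  qed
  then show ?thesis unfolding ball_growth_def using f by blast
qed

text \<open>The local results combined, with constants that are uniform in \<open>f\<close>, \<open>M\<close> and the cube. Local
  integrability of the potential supplies, in every cube, a point where the potential converges.\<close>

lemma potential_level_sets:
  fixes \<alpha> \<beta> p :: real
  assumes \<alpha>: "0 < \<alpha>" "\<alpha> < real CARD('n::finite)" and p: "1 \<le> p"
    and \<beta>: "0 < \<beta>" "real CARD('n) - \<alpha> * p < \<beta>"
  shows "\<exists>A>0. \<exists>b>0. \<forall>(f :: real ^ 'n \<Rightarrow> real) M a l.
    0 < M \<longrightarrow> ball_growth p (real CARD('n) - \<alpha> * p) M f \<longrightarrow> riesz_potential \<alpha> f \<in> L1_loc \<longrightarrow> 0 < l \<longrightarrow>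
      quasicontinuous \<beta> (cube a l) (riesz_potential \<alpha> f |` cube a l) \<and>
      hausdorff_content \<beta> (cube a l) \<le> ennreal (A * l powr \<beta>) \<and>
      (\<exists>c. \<forall>t\<ge>0. hausdorff_content \<beta> {x \<in> cube a l. \<exists>v. riesz_potential \<alpha> f x = Some v \<and> t < \<bar>v - c\<bar>}
         \<le> ennreal (A * l powr \<beta> * exp (- (b * t / M))))"
proof -
  let ?n = "real CARD('n)"
  let ?b = "\<beta> - (?n - \<alpha> * p)"
  let ?O = "oscillation_const CARD('n) \<alpha> \<beta> p" and ?L = "level_const CARD('n) \<alpha> \<beta> p"
  define A where "A = ?L * ?n powr \<beta> * 2 powr (2 * ?b)"
  define b where "b = ?b * ln 2 / ?O"
  have O: "0 < ?O"
    unfolding oscillation_const_def using \<alpha> \<beta> p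
    by (intro divide_pos_pos add_pos_nonneg shell_const_pos riesz_const_pos) auto
  have n: "0 < ?n" by simp
  have \<omega>: "0 < unit_ball_vol \<beta>" using \<beta> by simp
  then have L: "0 < ?L" unfolding level_const_def by (intro mult_pos_pos) auto
  have A: "0 < A" using L n unfolding A_def by (intro mult_pos_pos) auto
  have b: "0 < b" using O \<beta> unfolding b_def by (intro divide_pos_pos mult_pos_pos) auto
  show ?thesis
  proof (rule exI[of _ A], rule conjI[OF A], rule exI[of _ b], rule conjI[OF b], intro allI impI conjI)
    fix f :: "real ^ 'n \<Rightarrow> real" and M :: real and a :: "real ^ 'n" and l :: real
    assume M: "0 < M" and growth: "ball_growth p (?n - \<alpha> * p) M f"
      and L1: "riesz_potential \<alpha> f \<in> L1_loc" and l: "0 < l"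
    obtain z where z: "z \<in> cube a l" "z \<in> dom (riesz_potential \<alpha> f)"
      using cube_meets_dom[OF L1 l, of a] by blast
    interpret morrey_near_point \<alpha> \<beta> p M "?n * l" f z
      using \<alpha> \<beta> p M growth z l by unfold_locales (auto simp: riesz_potential_def split: if_splits)
    have sub: "cube a l \<subseteq> ball z (?n * l)" by (rule cube_subset_ball[OF z(1)])
    show "quasicontinuous \<beta> (cube a l) (riesz_potential \<alpha> f |` cube a l)"
      by (rule quasicontinuous_potential[OF open_cube sub])
    have level: "?L * (?n * l) powr \<beta> * 2 powr - (?b * (t / (?O * M) - 2)) = A * l powr \<beta> * exp (- (b * t / M))" for t
    proof -
      have "- (?b * (t / (?O * M) - 2)) = 2 * ?b + - (?b * t / (?O * M))"
        by (simp add: algebra_simps)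
      then have "2 powr - (?b * (t / (?O * M) - 2)) = 2 powr (2 * ?b) * 2 powr - (?b * t / (?O * M))"
        by (simp only: powr_add)
      moreover have "2 powr - (?b * t / (?O * M)) = exp (- (b * t / M))"
        by (simp add: powr_def b_def mult_ac)
      ultimately show ?thesis using l by (simp add: A_def powr_mult mult_ac)
    qed
    show "hausdorff_content \<beta> (cube a l) \<le> ennreal (A * l powr \<beta>)"
    proof -
      have "hausdorff_content \<beta> (cube a l) \<le> ennreal (unit_ball_vol \<beta> * (?n * l) powr \<beta>)"
        using hausdorff_content_mono[OF sub] hausdorff_content_ball_le[of "?n * l"] l
        by (meson d_pos less_imp_le order_trans)
      also have "\<dots> \<le> ennreal (A * l powr \<beta>)"
      proof (rule ennreal_leI)
        have "unit_ball_vol \<beta> * ((?n * l) powr \<beta> * 1) \<le> ?L * ((?n * l) powr \<beta> * 2 powr (2 * ?b))"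
          using level_const_ge L \<beta> by (intro mult_mono mult_left_mono ge_one_powr_ge_zero) auto
        then show "unit_ball_vol \<beta> * (?n * l) powr \<beta> \<le> A * l powr \<beta>"
          using l by (simp add: A_def powr_mult mult_ac)
      qed
      finally show ?thesis .
    qed
    show "\<exists>c. \<forall>t\<ge>0. hausdorff_content \<beta> {x \<in> cube a l. \<exists>v. riesz_potential \<alpha> f x = Some v \<and> t < \<bar>v - c\<bar>}
         \<le> ennreal (A * l powr \<beta> * exp (- (b * t / M)))"
      using exponential_decay[OF sub] unfolding level by blast
  qed
qed

section \<open>Choquet integrals of exponentially decaying functions\<close>

lemma choquet_integral_map_option:
  "choquet_integral \<beta> \<Omega> (\<lambda>x. map_option \<phi> (u x)) =
     (\<integral>\<^sup>+t\<in>{0..}. hausdorff_content \<beta> {x \<in> \<Omega>. \<exists>v. u x = Some v \<and> t < \<phi> v} \<partial>lborel)"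
proof -
  have "{x \<in> \<Omega>. \<exists>v. map_option \<phi> (u x) = Some v \<and> t < v} = {x \<in> \<Omega>. \<exists>v. u x = Some v \<and> t < \<phi> v}" for t
    by auto
  then show ?thesis unfolding choquet_integral_def by simp
qed

lemma nn_integral_exp_decay:
  fixes A b :: real
  assumes "0 \<le> A" "0 < b"
  shows "(\<integral>\<^sup>+t\<in>{0..}. ennreal (A * exp (- (b * t))) \<partial>lborel) = ennreal (A / b)"
proof -
  have "((\<lambda>t. - (A / b) * exp (- (b * t))) \<longlongrightarrow> - (A / b) * 0) at_top"
    using assms by (intro tendsto_mult tendsto_const filterlim_compose[OF exp_at_bot])
      (auto simp: filterlim_uminus_at_bot intro: filterlim_tendsto_pos_mult_at_top[OF tendsto_const] filterlim_ident)
  then have "(\<integral>\<^sup>+t. ennreal (A * exp (- (b * t))) * indicator {0..} t \<partial>lborel)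
     = ennreal (0 - (- (A / b) * exp (- (b * 0))))"
    using assms by (intro nn_integral_FTC_atLeast) (auto intro!: derivative_eq_intros)
  then show ?thesis by simp
qed

lemma nn_integral_arctan_decay:
  fixes A :: real
  assumes "0 \<le> A"
  shows "(\<integral>\<^sup>+t\<in>{0..}. ennreal (A * (2 / (1 + t\<^sup>2))) \<partial>lborel) = ennreal (A * pi)"
proof -
  have "((\<lambda>t. A * (2 * arctan t)) \<longlongrightarrow> A * (2 * (pi / 2))) at_top"
    by (intro tendsto_mult tendsto_const tendsto_arctan_at_top)
  moreover have "\<not> 1 + t\<^sup>2 < 0" for t :: real
    by (simp add: not_less add_nonneg_nonneg)
  ultimately have "(\<integral>\<^sup>+t. ennreal (A * (2 / (1 + t\<^sup>2))) * indicator {0..} t \<partial>lborel)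
     = ennreal (A * (2 * (pi / 2)) - A * (2 * arctan 0))"
    using assms
    by (intro nn_integral_FTC_atLeast)
      (auto intro!: derivative_eq_intros mult_nonneg_nonneg simp: divide_simps add_nonneg_eq_0_iff)
  then show ?thesis by simp
qed

lemma choquet_integral_le_of_exp_decay:
  assumes "\<And>t. 0 \<le> t \<Longrightarrow> hausdorff_content \<beta> {x \<in> \<Omega>. \<exists>v. u x = Some v \<and> t < \<phi> v}
            \<le> ennreal (A * exp (- (b * t)))" and "0 \<le> A" "0 < b"
  shows "choquet_integral \<beta> \<Omega> (\<lambda>x. map_option \<phi> (u x)) \<le> ennreal (A / b)"
proof -
  have "choquet_integral \<beta> \<Omega> (\<lambda>x. map_option \<phi> (u x))
     \<le> (\<integral>\<^sup>+t\<in>{0..}. ennreal (A * exp (- (b * t))) \<partial>lborel)"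
    unfolding choquet_integral_map_option
  proof (rule nn_integral_mono)
    fix t :: real
    show "hausdorff_content \<beta> {x \<in> \<Omega>. \<exists>v. u x = Some v \<and> t < \<phi> v} * indicator {0..} t
        \<le> ennreal (A * exp (- (b * t))) * indicator {0..} t"
      using assms(1)[of t] by (cases "0 \<le> t") simp_all
  qed
  then show ?thesis using assms(2,3) by (simp add: nn_integral_exp_decay)
qed

text \<open>The exponential exceeds \<open>t \<ge> 1\<close> only where \<open>\<bar>v - c\<bar> > (2 / b) ln t\<close>, a set of content at most \<open>A t\<^bsup>-2\<^esup>\<close>.
  Together with the bound \<open>A\<close> for \<open>t < 1\<close> this is at most \<open>2A / (1 + t\<^sup>2)\<close>, which has an elementary primitive.\<close>

lemma choquet_integral_exp_le:
  assumes decay: "\<And>t. 0 \<le> t \<Longrightarrow> hausdorff_content \<beta> {x \<in> \<Omega>. \<exists>v. u x = Some v \<and> t < \<bar>v - c\<bar>}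
            \<le> ennreal (A * exp (- (b * t)))"
    and total: "hausdorff_content \<beta> \<Omega> \<le> ennreal A" and "0 \<le> A" "0 < b"
  shows "choquet_integral \<beta> \<Omega> (\<lambda>x. map_option (\<lambda>v. exp (b / 2 * \<bar>v - c\<bar>)) (u x)) \<le> ennreal (A * pi)"
proof -
  have level: "hausdorff_content \<beta> {x \<in> \<Omega>. \<exists>v. u x = Some v \<and> t < exp (b / 2 * \<bar>v - c\<bar>)}
     \<le> ennreal (A * (2 / (1 + t\<^sup>2)))" if t: "0 \<le> t" for t
  proof (cases "t < 1")
    case True
    have "t\<^sup>2 \<le> 1" using t True by (simp add: power_le_one)
    then have "A * 1 \<le> A * (2 / (1 + t\<^sup>2))"
      using \<open>0 \<le> A\<close> by (intro mult_left_mono) (auto simp: pos_le_divide_eq add_pos_nonneg)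
    then have "ennreal A \<le> ennreal (A * (2 / (1 + t\<^sup>2)))" by (intro ennreal_leI) simp
    moreover have "hausdorff_content \<beta> {x \<in> \<Omega>. \<exists>v. u x = Some v \<and> t < exp (b / 2 * \<bar>v - c\<bar>)} \<le> hausdorff_content \<beta> \<Omega>"
      by (intro hausdorff_content_mono) auto
    ultimately show ?thesis using total by (meson order_trans)
  next
    case False
    then have t1: "1 \<le> t" by simp
    have "{x \<in> \<Omega>. \<exists>v. u x = Some v \<and> t < exp (b / 2 * \<bar>v - c\<bar>)}
       \<subseteq> {x \<in> \<Omega>. \<exists>v. u x = Some v \<and> 2 / b * ln t < \<bar>v - c\<bar>}"
    proof (intro Collect_mono conj_mono ex_mono imp_refl allI impI)
      fix v assume "t < exp (b / 2 * \<bar>v - c\<bar>)"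
      then have "ln t < ln (exp (b / 2 * \<bar>v - c\<bar>))" using t1 by (subst ln_less_cancel_iff) auto
      then have "ln t < b / 2 * \<bar>v - c\<bar>" by (simp only: ln_exp)
      then show "2 / b * ln t < \<bar>v - c\<bar>" using \<open>0 < b\<close> by (simp add: field_simps)
    qed
    then have "hausdorff_content \<beta> {x \<in> \<Omega>. \<exists>v. u x = Some v \<and> t < exp (b / 2 * \<bar>v - c\<bar>)}
       \<le> hausdorff_content \<beta> {x \<in> \<Omega>. \<exists>v. u x = Some v \<and> 2 / b * ln t < \<bar>v - c\<bar>}"
      by (rule hausdorff_content_mono)
    also have "\<dots> \<le> ennreal (A * exp (- (b * (2 / b * ln t))))"
      using t1 \<open>0 < b\<close> by (intro decay) simp
    also have "exp (- (b * (2 / b * ln t))) = 1 / t\<^sup>2"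
    proof -
      have "exp (- (b * (2 / b * ln t))) = inverse (exp (2 * ln t))" using \<open>0 < b\<close> by (simp add: exp_minus)
      also have "exp (2 * ln t) = t\<^sup>2" using t1 by (simp add: exp_double)
      finally show ?thesis by (simp add: inverse_eq_divide)
    qed
    also have "ennreal (A * (1 / t\<^sup>2)) \<le> ennreal (A * (2 / (1 + t\<^sup>2)))"
    proof (intro ennreal_leI mult_left_mono \<open>0 \<le> A\<close>)
      have "1 \<le> t\<^sup>2" using t1 by (simp add: one_le_power)
      then have "2 / (2 * t\<^sup>2) \<le> 2 / (1 + t\<^sup>2)"
        by (intro divide_left_mono mult_pos_pos) linarith+
      then show "1 / t\<^sup>2 \<le> 2 / (1 + t\<^sup>2)" by simp
    qed
    finally show ?thesis .
  qed
  have "choquet_integral \<beta> \<Omega> (\<lambda>x. map_option (\<lambda>v. exp (b / 2 * \<bar>v - c\<bar>)) (u x))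
     \<le> (\<integral>\<^sup>+t\<in>{0..}. ennreal (A * (2 / (1 + t\<^sup>2))) \<partial>lborel)"
    unfolding choquet_integral_map_option
  proof (rule nn_integral_mono)
    fix t :: real
    show "hausdorff_content \<beta> {x \<in> \<Omega>. \<exists>v. u x = Some v \<and> t < exp (b / 2 * \<bar>v - c\<bar>)} * indicator {0..} t
        \<le> ennreal (A * (2 / (1 + t\<^sup>2))) * indicator {0..} t"
      using level[of t] by (cases "0 \<le> t") simp_all
  qed
  then show ?thesis unfolding nn_integral_arctan_decay[OF \<open>0 \<le> A\<close>] .
qed

text \<open>Shifting levels by \<open>\<bar>c\<bar>\<close> reduces the level sets of \<open>\<bar>u\<bar>\<close> to those of \<open>\<bar>u - c\<bar>\<close>; the levels below \<open>\<bar>c\<bar>\<close> are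
  covered by the content of the whole set.\<close>

lemma choquet_integral_abs_finite:
  assumes decay: "\<And>t. 0 \<le> t \<Longrightarrow> hausdorff_content \<beta> {x \<in> \<Omega>. \<exists>v. u x = Some v \<and> t < \<bar>v - c\<bar>}
            \<le> ennreal (A * exp (- (b * t)))"
    and total: "hausdorff_content \<beta> \<Omega> \<le> ennreal A" and A: "0 \<le> A" and b: "0 < b"
  shows "choquet_integral \<beta> \<Omega> (\<lambda>x. map_option abs (u x)) < \<infinity>"
proof -
  have "choquet_integral \<beta> \<Omega> (\<lambda>x. map_option abs (u x)) \<le> ennreal (A * exp (b * \<bar>c\<bar>) / b)"
  proof (rule choquet_integral_le_of_exp_decay)
    fix t :: real assume t: "0 \<le> t"
    have e: "A * exp (b * \<bar>c\<bar>) * exp (- (b * t)) = A * exp (- (b * (t - \<bar>c\<bar>)))"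
      by (simp add: mult.assoc flip: exp_add) (simp add: algebra_simps)
    show "hausdorff_content \<beta> {x \<in> \<Omega>. \<exists>v. u x = Some v \<and> t < \<bar>v\<bar>}
        \<le> ennreal (A * exp (b * \<bar>c\<bar>) * exp (- (b * t)))"
    proof (cases "t < \<bar>c\<bar>")
      case True
      then have "A * 1 \<le> A * exp (- (b * (t - \<bar>c\<bar>)))"
        using A b by (intro mult_left_mono) (auto simp: mult_le_0_iff)
      then have "ennreal A \<le> ennreal (A * exp (- (b * (t - \<bar>c\<bar>))))" by (intro ennreal_leI) simp
      moreover have "hausdorff_content \<beta> {x \<in> \<Omega>. \<exists>v. u x = Some v \<and> t < \<bar>v\<bar>} \<le> hausdorff_content \<beta> \<Omega>"
        by (intro hausdorff_content_mono) auto
      ultimately show ?thesis unfolding e using total by (blast intro: order_trans)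
    next
      case False
      have "{x \<in> \<Omega>. \<exists>v. u x = Some v \<and> t < \<bar>v\<bar>} \<subseteq> {x \<in> \<Omega>. \<exists>v. u x = Some v \<and> t - \<bar>c\<bar> < \<bar>v - c\<bar>}"
        by (intro Collect_mono conj_mono ex_mono imp_refl allI impI) linarith
      then have "hausdorff_content \<beta> {x \<in> \<Omega>. \<exists>v. u x = Some v \<and> t < \<bar>v\<bar>}
          \<le> hausdorff_content \<beta> {x \<in> \<Omega>. \<exists>v. u x = Some v \<and> t - \<bar>c\<bar> < \<bar>v - c\<bar>}"
        by (rule hausdorff_content_mono)
      also have "\<dots> \<le> ennreal (A * exp (- (b * (t - \<bar>c\<bar>))))"
        using False by (intro decay) simp
      finally show ?thesis unfolding e .
    qed
  qed (use A b in auto)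
  then show ?thesis by (rule order_le_less_trans) simp
qed

section \<open>The endpoint estimate for Riesz potentials\<close>

theorem theorem1p4:
  fixes \<alpha> \<beta> p :: real
  assumes "0 < \<alpha>" and "\<alpha> < real CARD('n::finite)"
    and "1 \<le> p" and "p < real CARD('n) / \<alpha>"
    and "real CARD('n) - \<alpha> * p < \<beta>" and "\<beta> \<le> real CARD('n)"
  shows "(\<exists>C>0. \<forall>f :: real ^ 'n \<Rightarrow> real.
            f \<in> morrey_space \<alpha> p \<longrightarrow> riesz_potential \<alpha> f \<in> L1_loc \<longrightarrow>
              riesz_potential \<alpha> f \<in> bmo_space \<beta> \<and>
              bmo_norm \<beta> (riesz_potential \<alpha> f) \<le> ennreal C * morrey_norm \<alpha> p f)
       \<and> (\<exists>\<gamma>>0. \<exists>C\<^sub>0>0. \<forall>f :: real ^ 'n \<Rightarrow> real.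
            f \<in> morrey_space \<alpha> p \<longrightarrow> riesz_potential \<alpha> f \<in> L1_loc \<longrightarrow>
            \<not> (AE x in lebesgue. f x = 0) \<longrightarrow>
              (\<forall>a l. 0 < l \<longrightarrow> (\<exists>c. 
                 choquet_integral \<beta> (cube a l)
                   (\<lambda>x. map_option
                      (\<lambda>v. exp (\<gamma> * \<bar>v - c\<bar> / enn2real (morrey_norm \<alpha> p f)))
                      (riesz_potential \<alpha> f x))
                 \<le> ennreal (C\<^sub>0 * l powr \<beta>))))"
proof -
  have "p * \<alpha> < real CARD('n)" using assms(1,4) by (simp add: pos_less_divide_eq)
  then have \<beta>: "0 < \<beta>" using assms(5) by (simp add: mult.commute)
  \<comment> \<open>The loss in the Morrey bound on passing from cubes to balls of radius half the side.\<close>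
  define k where "k = 2 powr ((real CARD('n) - \<alpha> * p) / p)"
  have k: "0 < k" by (simp add: k_def)
  from potential_level_sets[OF assms(1-3) \<beta> assms(5)] obtain A b where A: "0 < A" and b: "0 < b"
    and key: "\<And>(f :: real ^ 'n \<Rightarrow> real) M a l.
      0 < M \<Longrightarrow> ball_growth p (real CARD('n) - \<alpha> * p) M f \<Longrightarrow> riesz_potential \<alpha> f \<in> L1_loc \<Longrightarrow> 0 < l \<Longrightarrow>
      quasicontinuous \<beta> (cube a l) (riesz_potential \<alpha> f |` cube a l) \<and>
      hausdorff_content \<beta> (cube a l) \<le> ennreal (A * l powr \<beta>) \<and>
      (\<exists>c. \<forall>t\<ge>0. hausdorff_content \<beta> {x \<in> cube a l. \<exists>v. riesz_potential \<alpha> f x = Some v \<and> t < \<bar>v - c\<bar>}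
         \<le> ennreal (A * l powr \<beta> * exp (- (b * t / M))))"
    by blast
  define C where "C = A * k / b"
  have C: "0 < C" using A b k by (simp add: C_def)
  have growth: "ball_growth p (real CARD('n) - \<alpha> * p) (M * k) f"
    if "f \<in> morrey_space \<alpha> p" "morrey_norm \<alpha> p f \<le> ennreal M" "0 < M" for f :: "real ^ 'n \<Rightarrow> real" and M
    using ball_growth_of_morrey_norm[of f \<alpha> p M] that assms(3) by (simp add: morrey_space_def k_def)
  have bmo: "bmo_norm \<beta> (riesz_potential \<alpha> f) \<le> ennreal C * morrey_norm \<alpha> p f"
      and loc: "riesz_potential \<alpha> f \<in> L1_loc_content \<beta>"
    if f: "f \<in> morrey_space \<alpha> p" and L1: "riesz_potential \<alpha> f \<in> L1_loc" for f :: "real ^ 'n \<Rightarrow> real"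
  proof -
    obtain m where m: "0 \<le> m" "morrey_norm \<alpha> p f = ennreal m"
      using f by (cases "morrey_norm \<alpha> p f") (auto simp: morrey_space_def)
    \<comment> \<open>The decay estimate divides by \<open>M\<close>, so it is used for every positive \<open>M \<ge> m\<close>;
      letting \<open>M\<close> decrease to \<open>m\<close> also covers \<open>m = 0\<close>.\<close>
    have le: "bmo_norm \<beta> (riesz_potential \<alpha> f) \<le> ennreal (C * M)" if M: "m \<le> M" "0 < M" for M
      unfolding bmo_norm_def
    proof (rule SUP_least)
      fix al :: "(real ^ 'n) \<times> real" assume "al \<in> UNIV \<times> {0<..}"
      then obtain a l where al: "al = (a, l)" and l: "0 < l" by (cases al) auto
      obtain c where c: "\<And>t. 0 \<le> t \<Longrightarrow> hausdorff_content \<beta> {x \<in> cube a l. \<exists>v. riesz_potential \<alpha> f x = Some v \<and> t < \<bar>v - c\<bar>}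
         \<le> ennreal (A * l powr \<beta> * exp (- (b / (M * k) * t)))"
        using key[OF _ growth[OF f _ M(2)] L1 l, of a] m M k by (auto simp: ennreal_leI)
      have "choquet_integral \<beta> (cube a l) (\<lambda>x. map_option (\<lambda>v. \<bar>v - c\<bar>) (riesz_potential \<alpha> f x))
          \<le> ennreal (A * l powr \<beta> / (b / (M * k)))"
        by (rule choquet_integral_le_of_exp_decay[OF c]) (use A b k M in auto)
      also have "A * l powr \<beta> / (b / (M * k)) = C * M * l powr \<beta>" by (simp add: C_def)
      finally have "choquet_integral \<beta> (cube a l) (\<lambda>x. map_option (\<lambda>v. \<bar>v - c\<bar>) (riesz_potential \<alpha> f x)) / ennreal (l powr \<beta>)
          \<le> ennreal (C * M * l powr \<beta>) / ennreal (l powr \<beta>)"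
        by (rule divide_right_mono_ennreal)
      also have "\<dots> = ennreal (C * M)" using l C M by (simp add: divide_ennreal)
      finally show "(case al of (a, l) \<Rightarrow> INF c.
            choquet_integral \<beta> (cube a l) (\<lambda>x. map_option (\<lambda>v. \<bar>v - c\<bar>) (riesz_potential \<alpha> f x)) / ennreal (l powr \<beta>))
          \<le> ennreal (C * M)"
        unfolding al prod.case by (rule INF_lower2[OF UNIV_I])
    qed
    have "bmo_norm \<beta> (riesz_potential \<alpha> f) \<le> ennreal (C * m)"
    proof (rule ennreal_le_epsilon)
      fix e :: real assume e: "0 < e"
      have "bmo_norm \<beta> (riesz_potential \<alpha> f) \<le> ennreal (C * (m + e / C))"
        using m e C by (intro le add_nonneg_pos) auto
      also have "C * (m + e / C) = C * m + e" using C by (simp add: algebra_simps)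
      finally show "bmo_norm \<beta> (riesz_potential \<alpha> f) \<le> ennreal (C * m) + ennreal e"
        using m e C by simp
    qed
    then show "bmo_norm \<beta> (riesz_potential \<alpha> f) \<le> ennreal C * morrey_norm \<alpha> p f"
      using m C by (simp add: ennreal_mult)
    show "riesz_potential \<alpha> f \<in> L1_loc_content \<beta>"
      unfolding L1_loc_content_def L1_content_def
    proof (intro CollectI allI impI conjI)
      fix a :: "real ^ 'n" and l :: real assume l: "0 < l"
      have M: "0 < m + 1" "morrey_norm \<alpha> p f \<le> ennreal (m + 1)" using m by (auto intro: ennreal_leI)
      note K = key[OF _ growth[OF f M(2,1)] L1 l, of a]
      show "quasicontinuous \<beta> (cube a l) (riesz_potential \<alpha> f |` cube a l)" using K M k by simp
      obtain c where c: "\<And>t. 0 \<le> t \<Longrightarrow> hausdorff_content \<beta> {x \<in> cube a l. \<exists>v. riesz_potential \<alpha> f x = Some v \<and> t < \<bar>v - c\<bar>}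
         \<le> ennreal (A * l powr \<beta> * exp (- (b / ((m + 1) * k) * t)))"
        using K M k by auto
      have restr: "{x \<in> cube a l. \<exists>v. (riesz_potential \<alpha> f |` cube a l) x = Some v \<and> t < \<bar>v - c\<bar>}
          = {x \<in> cube a l. \<exists>v. riesz_potential \<alpha> f x = Some v \<and> t < \<bar>v - c\<bar>}" for t
        by auto
      show "choquet_integral \<beta> (cube a l) (\<lambda>x. map_option abs ((riesz_potential \<alpha> f |` cube a l) x)) < \<infinity>"
      proof (rule choquet_integral_abs_finite)
        show "hausdorff_content \<beta> {x \<in> cube a l. \<exists>v. (riesz_potential \<alpha> f |` cube a l) x = Some v \<and> t < \<bar>v - c\<bar>}
            \<le> ennreal (A * l powr \<beta> * exp (- (b / ((m + 1) * k) * t)))" if "0 \<le> t" for t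
          unfolding restr by (rule c[OF that])
      qed (use K A b k M in auto)
    qed
  qed
  have exp_int: "\<exists>c. choquet_integral \<beta> (cube a l)
                   (\<lambda>x. map_option
                      (\<lambda>v. exp (b / (2 * k) * \<bar>v - c\<bar> / enn2real (morrey_norm \<alpha> p f)))
                      (riesz_potential \<alpha> f x))
                 \<le> ennreal (A * pi * l powr \<beta>)"
    if f: "f \<in> morrey_space \<alpha> p" and L1: "riesz_potential \<alpha> f \<in> L1_loc" and l: "0 < l"
    for f :: "real ^ 'n \<Rightarrow> real" and a l
  proof -
    obtain m where m: "0 \<le> m" "morrey_norm \<alpha> p f = ennreal m"
      using f by (cases "morrey_norm \<alpha> p f") (auto simp: morrey_space_def)
    have meq: "enn2real (morrey_norm \<alpha> p f) = m" using m by simp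
    \<comment> \<open>For \<open>m = 0\<close> division by zero makes the integrand the constant \<open>1\<close>, and the exponential
      formed with any positive \<open>M\<close> is at least that large.\<close>
    define M where "M = (if m = 0 then 1 else m)"
    have M: "0 < M" "morrey_norm \<alpha> p f \<le> ennreal M" using m by (auto simp: M_def)
    have Mk: "0 < M * k" using M k by simp
    note K = key[OF Mk growth[OF f M(2,1)] L1 l, of a]
    obtain c where c: "\<And>t. 0 \<le> t \<Longrightarrow> hausdorff_content \<beta> {x \<in> cube a l. \<exists>v. riesz_potential \<alpha> f x = Some v \<and> t < \<bar>v - c\<bar>}
         \<le> ennreal (A * l powr \<beta> * exp (- (b / (M * k) * t)))"
      using K by auto
    have "choquet_integral \<beta> (cube a l)
        (\<lambda>x. map_option (\<lambda>v. exp (b / (2 * k) * \<bar>v - c\<bar> / m)) (riesz_potential \<alpha> f x))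
       \<le> choquet_integral \<beta> (cube a l)
        (\<lambda>x. map_option (\<lambda>v. exp (b / (M * k) / 2 * \<bar>v - c\<bar>)) (riesz_potential \<alpha> f x))"
    proof -
      have le: "exp (b / (2 * k) * \<bar>v - c\<bar> / m) \<le> exp (b / (M * k) / 2 * \<bar>v - c\<bar>)" for v
        using b k by (auto simp: M_def mult_ac)
      have "{x \<in> cube a l. \<exists>v. riesz_potential \<alpha> f x = Some v \<and> t < exp (b / (2 * k) * \<bar>v - c\<bar> / m)}
         \<subseteq> {x \<in> cube a l. \<exists>v. riesz_potential \<alpha> f x = Some v \<and> t < exp (b / (M * k) / 2 * \<bar>v - c\<bar>)}" for t
        using le by (blast intro: less_le_trans)
      then show ?thesis unfolding choquet_integral_map_option
        by (intro nn_integral_mono mult_right_mono hausdorff_content_mono) simp_all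
    qed
    also have "\<dots> \<le> ennreal (A * l powr \<beta> * pi)"
      by (rule choquet_integral_exp_le[OF c]) (use K A b Mk in auto)
    finally show ?thesis unfolding meq by (intro exI[of _ c]) (simp add: mult_ac)
  qed
  show ?thesis
  proof (intro conjI)
    show "\<exists>C>0. \<forall>f :: real ^ 'n \<Rightarrow> real.
            f \<in> morrey_space \<alpha> p \<longrightarrow> riesz_potential \<alpha> f \<in> L1_loc \<longrightarrow>
              riesz_potential \<alpha> f \<in> bmo_space \<beta> \<and>
              bmo_norm \<beta> (riesz_potential \<alpha> f) \<le> ennreal C * morrey_norm \<alpha> p f"
    proof (rule exI[of _ C], intro conjI[OF C] allI impI)
      fix f :: "real ^ 'n \<Rightarrow> real"
      assume f: "f \<in> morrey_space \<alpha> p" "riesz_potential \<alpha> f \<in> L1_loc"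
      have "ennreal C * morrey_norm \<alpha> p f < \<infinity>"
        using f(1) by (simp add: morrey_space_def ennreal_mult_less_top)
      then show "riesz_potential \<alpha> f \<in> bmo_space \<beta> \<and>
              bmo_norm \<beta> (riesz_potential \<alpha> f) \<le> ennreal C * morrey_norm \<alpha> p f"
        using bmo[OF f] loc[OF f] by (auto simp: bmo_space_def intro: order_le_less_trans)
    qed
    show "\<exists>\<gamma>>0. \<exists>C\<^sub>0>0. \<forall>f :: real ^ 'n \<Rightarrow> real.
            f \<in> morrey_space \<alpha> p \<longrightarrow> riesz_potential \<alpha> f \<in> L1_loc \<longrightarrow>
            \<not> (AE x in lebesgue. f x = 0) \<longrightarrow>
              (\<forall>a l. 0 < l \<longrightarrow> (\<exists>c. 
                 choquet_integral \<beta> (cube a l)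
                   (\<lambda>x. map_option
                      (\<lambda>v. exp (\<gamma> * \<bar>v - c\<bar> / enn2real (morrey_norm \<alpha> p f)))
                      (riesz_potential \<alpha> f x))
                 \<le> ennreal (C\<^sub>0 * l powr \<beta>)))"
      by (rule exI[of _ "b / (2 * k)"], rule conjI, use b k in simp,
          rule exI[of _ "A * pi"], rule conjI, use A in simp, use exp_int in blast)
  qed
qed

end
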